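(* Let $\Omega\subset\mathbb{H}^n$ be an open domain and let $f:\Omega\to\mathbb{R}$ be twice continuously differentiable. Then $f$ is quaternionic plurisubharmonic if and only if at every point $q\in\Omega$ the matrix $\left(\frac{\partial^2 f}{\partial\bar q_i\partial q_j}(q)\right)_{i,j=1}^n$ is non-negative definite.
   Context: $\mathbb{H}$ is the skew field of quaternions, $q=t+ix+jy+kz$; $\mathbb{H}^n$ is a right $\mathbb{H}$-vector space with coordinates $q_m=t_m+ix_m+jy_m+kz_m$. For $\mathbb{H}$-valued functions set $$\frac{\partial f}{\partial\bar q_m}=\frac{\partial f}{\partial t_m}+i\frac{\partial f}{\partial x_m}+j\frac{\partial f}{\partial y_m}+k\frac{\partial f}{\partial z_m},\qquad \frac{\partial f}{\partial q_m}=\overline{\frac{\partial\bar f}{\partial\bar q_m}}=\frac{\partial f}{\partial t_m}-\frac{\partial f}{\partial x_m}i-\frac{\partial f}{\partial y_m}j-\frac{\partial f}{\partial z_m}k .$$ For real valued $f\in C^2$ the matrix $\left(\frac{\partial^2 f}{\partial\bar q_i\partial q_j}\right)$ is hyperhermitian (equal to its conjugate transpose). A hyperhermitian matrix $(a_{ij})$ is non-negative definite if $\sum_{i,j}\bar x_ia_{ij}x_j\ge0$ for all $x\in\mathbb{H}^n$. A real valued function $f$ on an open subset of $\mathbb{R}^m$ is subharmonic if it is upper semi-continuous and for every point $x_0$ and all sufficiently small $r>0$ one has $f(x_0)\le\int_{S(x_0,r)}f\,d\sigma$, where $\sigma$ is the Lebesgue measure on the sphere $S(x_0,r)$ normalized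 to total mass one. A function $f:\Omega\to\mathbb{R}$ is quaternionic plurisubharmonic if it is upper semi-continuous and its restriction to (the intersection of $\Omega$ with) any affine right quaternionic line $\{a+v\lambda:\lambda\in\mathbb{H}\}$, $v\ne0$, is subharmonic. *)

theory Defs
  imports "HOL-Analysis.Analysis"
begin

section \<open>The skew field of quaternions\<close>

codatatype quat = Quat (Qt: real) (Qx: real) (Qy: real) (Qz: real)

lemma quat_eqI [intro?]:
  "\<lbrakk>Qt p = Qt q; Qx p = Qx q; Qy p = Qy q; Qz p = Qz q\<rbrakk> \<Longrightarrow> p = q"
  by (rule quat.expand) simp

lemma quat_eq_iff: "p = q \<longleftrightarrow> Qt p = Qt q \<and> Qx p = Qx q \<and> Qy p = Qy q \<and> Qz p = Qz q"
  by (auto intro: quat_eqI)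

instantiation quat :: ab_group_add
begin

primcorec zero_quat where
  "Qt 0 = 0" | "Qx 0 = 0" | "Qy 0 = 0" | "Qz 0 = 0"

primcorec plus_quat where
  "Qt (p + q) = Qt p + Qt q"
| "Qx (p + q) = Qx p + Qx q"
| "Qy (p + q) = Qy p + Qy q"
| "Qz (p + q) = Qz p + Qz q"

primcorec uminus_quat where
  "Qt (- p) = - Qt p"
| "Qx (- p) = - Qx p"
| "Qy (- p) = - Qy p"
| "Qz (- p) = - Qz p"

primcorec minus_quat where
  "Qt (p - q) = Qt p - Qt q"
| "Qx (p - q) = Qx p - Qx q"
| "Qy (p - q) = Qy p - Qy q"
| "Qz (p - q) = Qz p - Qz q"

instance
  by standard (simp_all add: quat_eq_iff)

end

instantiation quat :: ring_1
begin

primcorec one_quat where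
  "Qt 1 = 1" | "Qx 1 = 0" | "Qy 1 = 0" | "Qz 1 = 0"

primcorec times_quat where
  "Qt (p * q) = Qt p * Qt q - Qx p * Qx q - Qy p * Qy q - Qz p * Qz q"
| "Qx (p * q) = Qt p * Qx q + Qx p * Qt q + Qy p * Qz q - Qz p * Qy q"
| "Qy (p * q) = Qt p * Qy q - Qx p * Qz q + Qy p * Qt q + Qz p * Qx q"
| "Qz (p * q) = Qt p * Qz q + Qx p * Qy q - Qy p * Qx q + Qz p * Qt q"

instance
  by standard (simp_all add: quat_eq_iff algebra_simps)

end

instantiation quat :: real_vector
begin

primcorec scaleR_quat where
  "Qt (r *\<^sub>R q) = r * Qt q"
| "Qx (r *\<^sub>R q) = r * Qx q"
| "Qy (r *\<^sub>R q) = r * Qy q"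
| "Qz (r *\<^sub>R q) = r * Qz q"

instance
  by standard (simp_all add: quat_eq_iff algebra_simps)

end

instantiation quat :: real_inner
begin

definition inner_quat_def:
  "inner p q = Qt p * Qt q + Qx p * Qx q + Qy p * Qy q + Qz p * Qz q"

definition norm_quat_def:
  "norm q = sqrt ((Qt q)\<^sup>2 + (Qx q)\<^sup>2 + (Qy q)\<^sup>2 + (Qz q)\<^sup>2)"

definition sgn_quat_def: "sgn q = q /\<^sub>R norm q" for q :: quat

definition dist_quat_def: "dist p q = norm (p - q)" for p q :: quat

definition uniformity_quat_def [code del]:
  "(uniformity :: (quat \<times> quat) filter) = (INF e\<in>{0 <..}. principal {(x, y). dist x y < e})"

definition open_quat_def [code del]:
  "open (U :: quat set) \<longleftrightarrow> (\<forall>x\<in>U. eventually (\<lambda>(x', y). x' = x \<longrightarrow> y \<in> U) uniformity)"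

instance
proof
  fix p q s :: quat and a :: real
  show "inner p q = inner q p" "inner (p + q) s = inner p s + inner q s"
    "inner (a *\<^sub>R p) q = a * inner p q"
    by (simp_all add: inner_quat_def algebra_simps)
  show "0 \<le> inner p p" "inner p p = 0 \<longleftrightarrow> p = 0"
    by (auto simp add: inner_quat_def quat_eq_iff add_nonneg_eq_0_iff)
  show "norm p = sqrt (inner p p)"
    by (simp add: inner_quat_def norm_quat_def power2_eq_square)
qed (rule sgn_quat_def dist_quat_def open_quat_def uniformity_quat_def)+

end

instantiation quat :: real_normed_div_algebra
begin

definition inverse_quat_def:
  "inverse q =
     Quat (Qt q / (norm q)\<^sup>2) (- Qx q / (norm q)\<^sup>2) (- Qy q / (norm q)\<^sup>2) (- Qz q / (norm q)\<^sup>2)"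

definition divide_quat_def: "p div q = p * inverse q" for p q :: quat

instance
proof
  fix p q :: quat and a :: real
  have n: "(norm p)\<^sup>2 = Qt p * Qt p + Qx p * Qx p + Qy p * Qy p + Qz p * Qz p" for p :: quat
    by (simp add: norm_quat_def power2_eq_square)
  show "inverse p * p = 1" "p * inverse p = 1" if "p \<noteq> 0"
  proof -
    have "(norm p)\<^sup>2 \<noteq> 0" using that by simp
    then show "inverse p * p = 1" "p * inverse p = 1"
      by (simp_all add: quat_eq_iff inverse_quat_def add_divide_distrib [symmetric]
          diff_divide_distrib [symmetric] mult.commute n)
  qed
  show "p div q = p * inverse q" by (rule divide_quat_def)
  show "inverse (0::quat) = 0" by (simp add: quat_eq_iff inverse_quat_def)
  show "a *\<^sub>R p * q = a *\<^sub>R (p * q)" "p * a *\<^sub>R q = a *\<^sub>R (p * q)"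
    by (simp_all add: quat_eq_iff algebra_simps)
  have "(norm (p * q))\<^sup>2 = (norm p * norm q)\<^sup>2"
    by (simp only: power_mult_distrib n times_quat.simps) algebra
  then show "norm (p * q) = norm p * norm q" by simp
qed

end

definition qi :: quat where "qi = Quat 0 1 0 0"
definition qj :: quat where "qj = Quat 0 0 1 0"
definition qk :: quat where "qk = Quat 0 0 0 1"

lemma quat_units_sel [simp]:
  "Qt qi = 0" "Qx qi = 1" "Qy qi = 0" "Qz qi = 0"
  "Qt qj = 0" "Qx qj = 0" "Qy qj = 1" "Qz qj = 0"
  "Qt qk = 0" "Qx qk = 0" "Qy qk = 0" "Qz qk = 1"
  by (simp_all add: qi_def qj_def qk_def)

lemma quat_units_mult:
  "qi * qi = -1" "qj * qj = -1" "qk * qk = -1"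
  "qi * qj = qk" "qj * qi = - qk" "qj * qk = qi" "qk * qj = - qi" "qk * qi = qj" "qi * qk = - qj"
  by (simp_all add: quat_eq_iff)

lemma quat_of_real_sel [simp]:
  "Qt (of_real r) = r" "Qx (of_real r) = 0" "Qy (of_real r) = 0" "Qz (of_real r) = 0"
  by (simp_all add: of_real_def)

lemma quat_coordinates:
  "q = of_real (Qt q) + qi * of_real (Qx q) + qj * of_real (Qy q) + qk * of_real (Qz q)"
  by (simp add: quat_eq_iff)

instantiation quat :: euclidean_space
begin

definition Basis_quat_def: "Basis = {1, qi, qj, qk}"

instance
proof
  show "(Basis :: quat set) \<noteq> {}" "finite (Basis :: quat set)"
    by (simp_all add: Basis_quat_def)
  have ne: "1 \<noteq> qi" "1 \<noteq> qj" "1 \<noteq> qk" "qi \<noteq> qj" "qi \<noteq> qk" "qj \<noteq> qk"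
    by (simp_all add: quat_eq_iff)
  show "inner u v = (if u = v then 1 else 0)" if "u \<in> Basis" "v \<in> Basis" for u v :: quat
    using that unfolding Basis_quat_def insert_iff empty_iff
    by (elim disjE FalseE) (simp_all add: inner_quat_def ne ne [symmetric])
  show "(\<forall>u\<in>Basis. inner x u = 0) \<longleftrightarrow> x = 0" for x :: quat
    unfolding quat_eq_iff [of x 0] by (simp add: Basis_quat_def inner_quat_def)
qed

end

lemma DIM_quat [simp]: "DIM(quat) = 4"
proof -
  have "distinct [1, qi, qj, qk]" by (simp add: quat_eq_iff)
  from distinct_card [OF this] show ?thesis by (simp add: Basis_quat_def)
qed

definition qcnj :: "quat \<Rightarrow> quat" where
  "qcnj q = Quat (Qt q) (- Qx q) (- Qy q) (- Qz q)"

lemma qcnj_sel [simp]: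
  "Qt (qcnj q) = Qt q" "Qx (qcnj q) = - Qx q" "Qy (qcnj q) = - Qy q" "Qz (qcnj q) = - Qz q"
  by (simp_all add: qcnj_def)

lemma qcnj_add: "qcnj (p + q) = qcnj p + qcnj q"
  by (simp add: quat_eq_iff)

lemma qcnj_mult: "qcnj (p * q) = qcnj q * qcnj p"
  by (simp add: quat_eq_iff algebra_simps)

lemma mult_qcnj: "q * qcnj q = of_real ((norm q)\<^sup>2)"
  by (simp add: quat_eq_iff norm_quat_def power2_eq_square)

lemma bounded_linear_qcnj: "bounded_linear qcnj"
  by (rule bounded_linear_intro [of _ 1]) (simp_all add: quat_eq_iff norm_quat_def)


section \<open>Quaternionic derivatives\<close>

definition dir_deriv :: "'a::real_normed_vector \<Rightarrow> ('a \<Rightarrow> 'b::real_normed_vector) \<Rightarrow> 'a \<Rightarrow> 'b" where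
  "dir_deriv u g x = vector_derivative (\<lambda>s. g (x + s *\<^sub>R u)) (at 0)"

text \<open>The real coordinates \<open>t\<^sub>m, x\<^sub>m, y\<^sub>m, z\<^sub>m\<close> correspond to the directions
  \<open>axis m 1\<close>, \<open>axis m qi\<close>, \<open>axis m qj\<close>, \<open>axis m qk\<close>. The imaginary units stand on the left
  in \<open>deriv_qbar\<close> and on the right in \<open>deriv_q\<close>.\<close>

definition deriv_qbar :: "'n \<Rightarrow> (quat ^ 'n::finite \<Rightarrow> quat) \<Rightarrow> quat ^ 'n \<Rightarrow> quat" where
  "deriv_qbar m g q =
     dir_deriv (axis m 1) g q + qi * dir_deriv (axis m qi) g q
     + qj * dir_deriv (axis m qj) g q + qk * dir_deriv (axis m qk) g q"

definition deriv_q :: "'n \<Rightarrow> (quat ^ 'n::finite \<Rightarrow> quat) \<Rightarrow> quat ^ 'n \<Rightarrow> quat" where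
  "deriv_q m g q =
     dir_deriv (axis m 1) g q - dir_deriv (axis m qi) g q * qi
     - dir_deriv (axis m qj) g q * qj - dir_deriv (axis m qk) g q * qk"

lemma deriv_q_eq_cnj:
  assumes "g differentiable at q"
  shows "deriv_q m g q = qcnj (deriv_qbar m (\<lambda>p. qcnj (g p)) q)"
proof -
  obtain g' where g': "(g has_derivative g') (at q)"
    using assms by (auto simp: differentiable_def)
  have *: "dir_deriv u (\<lambda>p. qcnj (g p)) q = qcnj (dir_deriv u g q)" for u
  proof -
    have "((\<lambda>s::real. q + s *\<^sub>R u) has_vector_derivative u) (at 0)"
      by (auto intro!: derivative_eq_intros simp: has_vector_derivative_def)
    then have "((\<lambda>s. g (q + s *\<^sub>R u)) has_vector_derivative g' u) (at 0)"
      using vector_derivative_diff_chain_within [of "\<lambda>s. q + s *\<^sub>R u" u 0 UNIV g g']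
        has_derivative_at_withinI [OF g'] by (simp add: o_def)
    moreover from this have
      "((\<lambda>s. qcnj (g (q + s *\<^sub>R u))) has_vector_derivative qcnj (g' u)) (at 0)"
      by (rule bounded_linear.has_vector_derivative [OF bounded_linear_qcnj])
    ultimately show ?thesis
      by (simp add: dir_deriv_def vector_derivative_at)
  qed
  show ?thesis
    unfolding deriv_q_def deriv_qbar_def * by (simp add: quat_eq_iff)
qed

definition quat_hessian :: "(quat ^ 'n::finite \<Rightarrow> real) \<Rightarrow> quat ^ 'n \<Rightarrow> quat ^ 'n ^ 'n" where
  "quat_hessian f q = (\<chi> i j. deriv_qbar i (deriv_q j (\<lambda>p. of_real (f p))) q)"

definition hyperhermitian :: "quat ^ 'n ^ 'n \<Rightarrow> bool" where
  "hyperhermitian A \<longleftrightarrow> (\<forall>i j. A $ i $ j = qcnj (A $ j $ i))"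

text \<open>The inequality \<open>0 \<le> p\<close> for a quaternion \<open>p\<close> means that \<open>p\<close> is a non-negative real;
  for hyperhermitian \<open>A\<close> the quantity below is automatically real.\<close>

definition nonneg_definite :: "quat ^ 'n::finite ^ 'n \<Rightarrow> bool" where
  "nonneg_definite A \<longleftrightarrow> hyperhermitian A \<and>
     (\<forall>x :: quat ^ 'n. let p = (\<Sum>i\<in>UNIV. \<Sum>j\<in>UNIV. qcnj (x $ i) * A $ i $ j * x $ j)
        in p \<in> \<real> \<and> 0 \<le> Qt p)"


section \<open>Twice continuously differentiable functions\<close>

definition C2_on :: "'a::real_normed_vector set \<Rightarrow> ('a \<Rightarrow> 'b::real_normed_vector) \<Rightarrow> bool" where
  "C2_on U f \<longleftrightarrow>
     (\<exists>(f' :: 'a \<Rightarrow> 'a \<Rightarrow>\<^sub>L 'b) (f'' :: 'a \<Rightarrow> 'a \<Rightarrow>\<^sub>L 'a \<Rightarrow>\<^sub>L 'b).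
        (\<forall>x\<in>U. (f has_derivative blinfun_apply (f' x)) (at x)) \<and>
        (\<forall>x\<in>U. (f' has_derivative blinfun_apply (f'' x)) (at x)) \<and>
        continuous_on U f'')"


section \<open>Subharmonic and quaternionic plurisubharmonic functions\<close>

definition usc_on :: "'a::topological_space set \<Rightarrow> ('a \<Rightarrow> real) \<Rightarrow> bool" where
  "usc_on U f \<longleftrightarrow> (\<forall>c. openin (top_of_set U) {x \<in> U. f x < c})"

text \<open>The normalized Lebesgue measure on the sphere of centre \<open>c\<close> and radius \<open>r > 0\<close>, as a
  Borel measure on the ambient space: the normalized measure of a Borel set \<open>E\<close> is the proportion
  of the volume of the unit ball lying in the cone \<open>{x. c + r *\<^sub>R sgn x \<in> E}\<close>.
  The value at \<open>x = 0\<close> is irrelevant since \<open>{0}\<close> is a null set.\<close>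

definition sphere_measure :: "'a::euclidean_space \<Rightarrow> real \<Rightarrow> 'a measure" where
  "sphere_measure c r = distr (uniform_measure lborel (ball 0 1)) borel (\<lambda>x. c + r *\<^sub>R sgn x)"

lemma borel_measurable_sphere_proj [measurable]:
  "(\<lambda>x::'a::euclidean_space. c + r *\<^sub>R sgn x) \<in> borel_measurable borel"
  unfolding sgn_div_norm by measurable

lemma sets_sphere_measure [simp, measurable_cong]: "sets (sphere_measure c r) = sets borel"
  by (simp add: sphere_measure_def)

lemma emeasure_sphere_measure_UNIV:
  "emeasure (sphere_measure c r) UNIV = 1" for c :: "'a::euclidean_space"
proof -
  have "emeasure lborel (ball (0::'a) 1) \<noteq> 0"
    using content_ball_pos [of 1 "0::'a"] by (auto simp: measure_def)
  moreover have "emeasure lborel (ball (0::'a) 1) \<noteq> \<infinity>"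
    using emeasure_lborel_ball_finite [of "0::'a" 1] by auto
  ultimately show ?thesis
    by (simp add: sphere_measure_def emeasure_distr ennreal_divide_self less_top)
qed

lemma AE_sphere_measure:
  assumes "r > 0"
  shows "AE y in sphere_measure c r. y \<in> sphere c r"
proof -
  have "AE x in lborel. x \<noteq> (0::'a)" by (rule AE_lborel_singleton)
  then have "AE x in uniform_measure lborel (ball 0 1). x \<noteq> (0::'a)"
    by (intro AE_uniform_measureI) auto
  then have "AE x in uniform_measure lborel (ball (0::'a) 1). c + r *\<^sub>R sgn x \<in> sphere c r"
    by eventually_elim (use assms in \<open>simp add: dist_norm norm_sgn\<close>)
  then show ?thesis
    unfolding sphere_measure_def by (subst AE_distr_iff) auto
qed

text \<open>An upper semicontinuous real function is bounded above on the sphere, so that its integral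
  exists in \<open>[-\<infinity>, \<infinity>)\<close>; a real lower bound on it forces integrability, which has to be stated
  because the library's integral of a non-integrable function is \<open>0\<close>.\<close>

definition subharmonic_on :: "'a::euclidean_space set \<Rightarrow> ('a \<Rightarrow> real) \<Rightarrow> bool" where
  "subharmonic_on U f \<longleftrightarrow> usc_on U f \<and>
     (\<forall>x\<in>U. eventually (\<lambda>r. sphere x r \<subseteq> U \<and>
        set_integrable (sphere_measure x r) (sphere x r) f \<and>
        f x \<le> (LINT y:sphere x r|sphere_measure x r. f y)) (at_right 0))"

definition scaleQ_right :: "quat ^ 'n \<Rightarrow> quat \<Rightarrow> quat ^ 'n" where
  "scaleQ_right v l = (\<chi> m. v $ m * l)"

text \<open>The line through \<open>a\<close> in direction \<open>v\<close> is identified with the quaternions, hence with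
  Euclidean 4-space, by \<open>l \<mapsto> a + v l\<close>; this is an isometry up to the factor \<open>norm v\<close>.\<close>

definition quat_psh_on :: "(quat ^ 'n::finite) set \<Rightarrow> (quat ^ 'n \<Rightarrow> real) \<Rightarrow> bool" where
  "quat_psh_on U f \<longleftrightarrow> usc_on U f \<and>
     (\<forall>a v. v \<noteq> 0 \<longrightarrow>
        subharmonic_on {l. a + scaleQ_right v l \<in> U} (\<lambda>l. f (a + scaleQ_right v l)))"

end

theory Submission
  imports Defs
begin

text \<open>
  Let \<open>H\<close> be the second derivative of \<open>f\<close> at \<open>q\<close>, a symmetric real bilinear form. Expanding the
  quaternionic derivatives shows that the form with the matrix \<open>quat_hessian f q\<close> has at \<open>v\<close> the value
  \<open>\<Sum>c\<in>Basis. H (v c) (v c)\<close>, where \<open>Basis\<close> consists of \<open>1, i, j, k\<close>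
  (\<open>quat_hessian_eq\<close>, \<open>nonneg_definite_iff_traces_nonneg\<close>). This value is the Laplacian at \<open>l = 0\<close> of
  the restriction \<open>g l = f (q + v l)\<close>. The theorem therefore reduces to the classical fact that a twice
  continuously differentiable function \<open>g\<close> on an open set of the quaternions is subharmonic if and
  only if its Laplacian is non-negative.

  Both directions of this fact rest on the multiplicative structure of the quaternions. For
  \<open>norm l = r\<close> the average of \<open>g (x + l w)\<close> over unit quaternions \<open>w\<close> is the mean of \<open>g\<close> over the sphere of
  radius \<open>r\<close>, since multiplication by a unit quaternion preserves the measure on the sphere
  (\<open>integral_sphere_measure_eq_average_quat\<close>). Moreover, for every \<open>u \<noteq> 0\<close> the quaternions \<open>c u\<close>,
  \<open>c \<in> Basis\<close>, form an orthogonal basis of vectors of equal length, so that the sum of the second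
  differences of \<open>g\<close> in these directions is \<open>(norm u)\<^sup>2 \<Delta> g (p) + o((norm u)\<^sup>2)\<close>, uniformly for \<open>p\<close> in
  compact sets (\<open>line_second_difference_uniform\<close>).

  If \<open>\<Delta> g (x) < 0\<close>, then averaging the second differences at \<open>x\<close> over \<open>u = r w\<close> gives eight times the
  difference of the spherical mean and \<open>g x\<close>; it is negative for small \<open>r\<close>, and \<open>g\<close> is not
  subharmonic (\<open>sphere_mean_le_second_difference\<close>). If \<open>\<Delta> g \<ge> 0\<close>, then the average of \<open>g (x + l w)\<close>, as a
  function of \<open>l\<close>, satisfies the maximum principle; being radial, it takes its maximum over
  \<open>cball 0 r\<close> at every point of the boundary, where its value is the spherical mean, and its value at
  \<open>0\<close> is \<open>g x\<close> (\<open>sub_mean_value\<close>).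
\<close>

section \<open>Second derivatives and second differences\<close>

lemma has_derivative_line:
  "((\<lambda>s. p + s *\<^sub>R u) has_derivative (\<lambda>h. h *\<^sub>R u)) (at s within S)"
  for p u :: "'a::real_normed_vector"
  by (auto intro!: derivative_eq_intros)

lemma mem_ball_add: "p + x \<in> ball p d \<longleftrightarrow> norm x < d" for p x :: "'a::real_normed_vector"
  unfolding mem_ball dist_norm by (metis add_diff_cancel_left' norm_minus_commute)

text \<open>The mixed second difference of \<open>f\<close> over the parallelogram spanned by \<open>t u\<close> and \<open>t w\<close> does not
  change when \<open>u\<close> and \<open>w\<close> are exchanged. By the mean value theorem in the direction \<open>u\<close> it is
  \<open>t\<^sup>2 B w u\<close> up to \<open>o(t\<^sup>2)\<close>, and in the same way \<open>t\<^sup>2 B u w\<close> up to \<open>o(t\<^sup>2)\<close>. This symmetry is what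
  makes the quaternionic Hessian hyperhermitian.\<close>

lemma second_derivative_symmetric:
  fixes f :: "'a::real_normed_vector \<Rightarrow> real" and f' :: "'a \<Rightarrow> 'a \<Rightarrow>\<^sub>L real"
  assumes "open U" "p \<in> U"
    and f': "\<And>x. x \<in> U \<Longrightarrow> (f has_derivative blinfun_apply (f' x)) (at x)"
    and f'': "(f' has_derivative blinfun_apply B) (at p)"
  shows "B u w = B w u"
proof -
  define D where "D t u w = f (p + t *\<^sub>R u + t *\<^sub>R w) - f (p + t *\<^sub>R u) - f (p + t *\<^sub>R w) + f p"
    for t u w
  have approx: "\<exists>\<delta>>0. \<forall>t. 0 < t \<and> t < \<delta> \<longrightarrow> \<bar>D t u w - t\<^sup>2 * B w u\<bar> \<le> \<epsilon> * t\<^sup>2"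
    if "\<epsilon> > 0" for \<epsilon> u w
  proof -
    (* Increments of length at most t C occur below; two Taylor remainders of size e t C, evaluated
       at t u with norm u \<le> C, together contribute at most \<epsilon> t^2. *)
    define C where "C = norm u + norm w + 1"
    define e where "e = \<epsilon> / (2 * C * C)"
    have C: "C > 0" "norm u \<le> C" by (auto simp: C_def add_pos_nonneg)
      (smt (verit) norm_ge_zero)
    have e: "e > 0" using C \<open>\<epsilon> > 0\<close> by (simp add: e_def)
    obtain d1 where d1: "d1 > 0"
      "\<And>y. norm (y - p) < d1 \<Longrightarrow> norm (f' y - f' p - B (y - p)) \<le> e * norm (y - p)"
      using f'' e unfolding has_derivative_at_alt by blast
    obtain d2 where d2: "d2 > 0" "ball p d2 \<subseteq> U"
      using assms(1,2) open_contains_ball by blast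
    define \<delta> where "\<delta> = min d1 d2 / C"
    have "\<delta> > 0" using d1 d2 C by (simp add: \<delta>_def)
    moreover have "\<bar>D t u w - t\<^sup>2 * B w u\<bar> \<le> \<epsilon> * t\<^sup>2" if t: "0 < t" "t < \<delta>" for t
    proof -
      have tC: "t * C < d1" "t * C < d2"
        using t C by (auto simp: \<delta>_def field_simps)
      have small: "norm ((s * t) *\<^sub>R u + r *\<^sub>R w) \<le> t * C" if "0 \<le> s" "s \<le> 1" "0 \<le> r" "r \<le> t" for s r
      proof -
        have "norm ((s * t) *\<^sub>R u + r *\<^sub>R w) \<le> (s * t) * norm u + r * norm w"
          using that t by (intro norm_triangle_le) simp
        also have "\<dots> \<le> t * norm u + t * norm w"
          using that t by (intro add_mono mult_right_mono) (auto simp: mult_left_le_one_le)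
        also have "\<dots> \<le> t * C" using t by (simp add: C_def algebra_simps)
        finally show ?thesis .
      qed
      have inU: "p + ((s * t) *\<^sub>R u + r *\<^sub>R w) \<in> U" if "0 \<le> s" "s \<le> 1" "0 \<le> r" "r \<le> t" for s r
        using small[OF that] d2 tC by (intro subsetD[OF d2(2)]) (simp only: mem_ball_add)
      (* phi 1 - phi 0 is the mixed second difference, as an increment in the direction u. *)
      define \<phi> where "\<phi> s = f (p + ((s * t) *\<^sub>R u + t *\<^sub>R w)) - f (p + ((s * t) *\<^sub>R u + 0 *\<^sub>R w))" for s
      have line: "((\<lambda>s. f (p + ((s * t) *\<^sub>R u + r *\<^sub>R w))) has_derivative
          (\<lambda>h. f' (p + ((s * t) *\<^sub>R u + r *\<^sub>R w)) ((h * t) *\<^sub>R u))) (at s within {0..1})"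
        if "0 \<le> s" "s \<le> 1" "0 \<le> r" "r \<le> t" for s r
      proof -
        have eq: "p + ((s * t) *\<^sub>R u + r *\<^sub>R w) = (p + r *\<^sub>R w) + s *\<^sub>R (t *\<^sub>R u)" for s
          by simp
        show ?thesis
          using has_derivative_compose[OF has_derivative_line f'[OF inU[OF that, unfolded eq]]]
          unfolding eq by (simp only: scaleR_scaleR)
      qed
      have "(\<phi> has_derivative (\<lambda>h. f' (p + ((s * t) *\<^sub>R u + t *\<^sub>R w)) ((h * t) *\<^sub>R u)
          - f' (p + ((s * t) *\<^sub>R u + 0 *\<^sub>R w)) ((h * t) *\<^sub>R u))) (at s within {0..1})"
        if "0 \<le> s" "s \<le> 1" for s
        unfolding \<phi>_def using that t by (intro has_derivative_diff line) auto
      from mvt_simple[OF zero_less_one this]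
      obtain s where s: "s \<in> {0<..<1}" and "\<phi> 1 - \<phi> 0 =
          f' (p + ((s * t) *\<^sub>R u + t *\<^sub>R w)) (((1 - 0) * t) *\<^sub>R u)
          - f' (p + ((s * t) *\<^sub>R u + 0 *\<^sub>R w)) (((1 - 0) * t) *\<^sub>R u)"
        by auto
      moreover have "\<phi> 1 - \<phi> 0 = D t u w"
        by (simp add: \<phi>_def D_def algebra_simps)
      moreover define a where "a = (s * t) *\<^sub>R u + t *\<^sub>R w"
      moreover define b where "b = (s * t) *\<^sub>R u + 0 *\<^sub>R w"
      moreover have "(1 - 0) * t = t" by simp
      ultimately have D: "D t u w = t * (f' (p + a) u - f' (p + b) u)"
        by (simp only: blinfun.scaleR_right) (simp add: algebra_simps)
      have na: "norm a \<le> t * C" and nb: "norm b \<le> t * C"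
        unfolding a_def b_def using s t by (auto intro!: small simp del: scaleR_zero_left)
      define R where "R h = f' (p + h) - f' p - B h" for h
      have R: "norm (R h) \<le> e * (t * C)" if "norm h \<le> t * C" for h
      proof -
        have "norm (R h) \<le> e * norm h"
          using d1(2)[of "p + h"] that tC by (simp add: R_def)
        then show ?thesis using that e by (smt (verit) mult_left_mono)
      qed
      have "B a - B b = t *\<^sub>R B w"
        by (simp add: a_def b_def blinfun.scaleR_right blinfun.add_right)
      then have "f' (p + a) - f' (p + b) = t *\<^sub>R B w + (R a - R b)"
        by (simp add: R_def algebra_simps)
      then have "f' (p + a) u - f' (p + b) u = t * B w u + (R a - R b) u"
        by (metis blinfun.add_left blinfun.diff_left blinfun.scaleR_left real_scaleR_def)
      then have "D t u w - t\<^sup>2 * B w u = t * (R a - R b) u"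
        by (simp add: D algebra_simps power2_eq_square)
      moreover have "\<bar>(R a - R b) u\<bar> \<le> (2 * (e * (t * C))) * C"
      proof -
        have "\<bar>(R a - R b) u\<bar> \<le> norm (R a - R b) * norm u"
          using norm_blinfun[of "R a - R b" u] by simp
        also have "\<dots> \<le> (2 * (e * (t * C))) * C"
          using R[OF na] R[OF nb] norm_triangle_ineq4[of "R a" "R b"] C e t
          by (intro mult_mono) auto
        finally show ?thesis .
      qed
      ultimately have "\<bar>D t u w - t\<^sup>2 * B w u\<bar> \<le> t * ((2 * (e * (t * C))) * C)"
        using t by (simp add: abs_mult)
      also have "\<dots> = \<epsilon> * t\<^sup>2"
        using C by (simp add: e_def power2_eq_square)
      finally show ?thesis .
    qed
    ultimately show ?thesis by blast
  qed
  have "\<bar>B w u - B u w\<bar> \<le> \<epsilon>" if "\<epsilon> > 0" for \<epsilon>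
  proof -
    have half: "\<epsilon> / 2 > 0" using that by simp
    obtain \<delta>1 where 1: "\<delta>1 > 0"
      "\<And>t. 0 < t \<and> t < \<delta>1 \<Longrightarrow> \<bar>D t u w - t\<^sup>2 * B w u\<bar> \<le> (\<epsilon> / 2) * t\<^sup>2"
      using approx half by metis
    obtain \<delta>2 where 2: "\<delta>2 > 0"
      "\<And>t. 0 < t \<and> t < \<delta>2 \<Longrightarrow> \<bar>D t w u - t\<^sup>2 * B u w\<bar> \<le> (\<epsilon> / 2) * t\<^sup>2"
      using approx half by metis
    define t where "t = min \<delta>1 \<delta>2 / 2"
    have t: "0 < t" "t < \<delta>1" "t < \<delta>2" using 1 2 by (auto simp: t_def)
    have "D t u w = D t w u" by (simp add: D_def algebra_simps)
    then have "\<bar>t\<^sup>2 * B w u - t\<^sup>2 * B u w\<bar> \<le> \<epsilon> * t\<^sup>2"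
      using 1(2)[of t] 2(2)[of t] t by (smt (verit) field_sum_of_halves distrib_right)
    then have "t\<^sup>2 * \<bar>B w u - B u w\<bar> \<le> t\<^sup>2 * \<epsilon>"
      by (simp only: abs_mult abs_power2 mult.commute[of \<epsilon>] flip: right_diff_distrib)
    then show ?thesis using t by simp
  qed
  then have "\<bar>B w u - B u w\<bar> \<le> 0" by (rule field_le_epsilon) simp
  then show ?thesis by simp
qed

text \<open>Uniform continuity of \<open>g\<close> on \<open>K\<close> would compare only points of \<open>K\<close> with each other; here one of the
  two points may leave \<open>K\<close>. A Lebesgue number of the cover of \<open>K\<close> by open sets on which \<open>g\<close> varies by
  less than \<open>\<epsilon>\<close> serves as \<open>\<delta>\<close>.\<close>

lemma uniform_continuity_around_compact:
  fixes g :: "'a::metric_space \<Rightarrow> 'b::metric_space"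
  assumes "open U" "continuous_on U g" "compact K" "K \<subseteq> U" "\<epsilon> > 0"
  obtains \<delta> where "\<delta> > 0" "\<And>p. p \<in> K \<Longrightarrow> ball p \<delta> \<subseteq> U"
    "\<And>p y. p \<in> K \<Longrightarrow> y \<in> ball p \<delta> \<Longrightarrow> dist (g y) (g p) < \<epsilon>"
proof -
  define G where "G = {V. open V \<and> V \<subseteq> U \<and> (\<forall>y\<in>V. \<forall>z\<in>V. dist (g y) (g z) < \<epsilon>)}"
  have "K \<subseteq> \<Union>G"
  proof
    fix p assume "p \<in> K"
    then have p: "p \<in> U" using assms by auto
    define V where "V = U \<inter> g -` ball (g p) (\<epsilon> / 2)"
    have "open V"
      unfolding V_def using assms by (intro continuous_open_preimage) auto
    moreover have "\<forall>y\<in>V. \<forall>z\<in>V. dist (g y) (g z) < \<epsilon>"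
      unfolding V_def using dist_triangle_half_r[of "g p" _ \<epsilon>] by auto
    moreover have "p \<in> V" using p \<open>\<epsilon> > 0\<close> by (simp add: V_def)
    ultimately show "p \<in> \<Union>G" by (auto simp: G_def V_def)
  qed
  moreover have "open V" if "V \<in> G" for V using that by (simp add: G_def)
  ultimately obtain \<delta> where \<delta>: "\<delta> > 0" "\<And>p. p \<in> K \<Longrightarrow> \<exists>V\<in>G. ball p \<delta> \<subseteq> V"
    using Heine_Borel_lemma[OF \<open>compact K\<close>, of G] by metis
  show ?thesis
  proof (rule that[OF \<delta>(1)])
    fix p assume p: "p \<in> K"
    then obtain V where V: "V \<in> G" "ball p \<delta> \<subseteq> V" using \<delta> by blast
    then show "ball p \<delta> \<subseteq> U" by (auto simp: G_def)
    show "dist (g y) (g p) < \<epsilon>" if "y \<in> ball p \<delta>" for y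
      using V that \<delta>(1) by (auto simp: G_def subset_iff)
  qed
qed

text \<open>In the sum of the Taylor formulas for \<open>u\<close> and \<open>- u\<close> the first order terms cancel. The Lagrange
  remainder contains \<open>f''\<close> at an intermediate point, and the previous lemma replaces that point by
  \<open>p\<close>, with an error that is uniform in \<open>p\<close>.\<close>

lemma second_difference_uniform:
  fixes f :: "'a::real_normed_vector \<Rightarrow> real" and f' :: "'a \<Rightarrow> 'a \<Rightarrow>\<^sub>L real"
  assumes "open U"
    and f': "\<And>x. x \<in> U \<Longrightarrow> (f has_derivative blinfun_apply (f' x)) (at x)"
    and f'': "\<And>x. x \<in> U \<Longrightarrow> (f' has_derivative blinfun_apply (f'' x)) (at x)"
    and "continuous_on U f''" "compact K" "K \<subseteq> U" "\<epsilon> > 0"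
  obtains \<delta> where "\<delta> > 0"
    "\<And>p u. p \<in> K \<Longrightarrow> norm u < \<delta> \<Longrightarrow>
      \<bar>f (p + u) + f (p - u) - 2 * f p - f'' p u u\<bar> \<le> \<epsilon> * (norm u)\<^sup>2"
proof -
  obtain \<delta> where \<delta>: "\<delta> > 0" "\<And>p. p \<in> K \<Longrightarrow> ball p \<delta> \<subseteq> U"
    "\<And>p y. p \<in> K \<Longrightarrow> y \<in> ball p \<delta> \<Longrightarrow> dist (f'' y) (f'' p) < \<epsilon>"
    using uniform_continuity_around_compact[OF assms(1,4-7)] by blast
  have taylor: "\<bar>f (p + u) - f p - f' p u - f'' p u u / 2\<bar> \<le> \<epsilon> * (norm u)\<^sup>2 / 2"
    if p: "p \<in> K" and u: "norm u < \<delta>" for p u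
  proof -
    have near: "p + s *\<^sub>R u \<in> ball p \<delta>" if "0 \<le> s" "s \<le> 1" for s
      using that u mult_left_le_one_le[of "norm u" s] by (simp add: dist_norm)
    have inU: "p + s *\<^sub>R u \<in> U" if "0 \<le> s" "s \<le> 1" for s
      using near[OF that] \<delta>(2)[OF p] by auto
    (* The derivatives of s |-> f (p + s u) of orders 0, 1 and 2. *)
    define d where "d m s = (if m = 0 then f (p + s *\<^sub>R u) else if m = 1 then f' (p + s *\<^sub>R u) u
        else f'' (p + s *\<^sub>R u) u u)" for m :: nat and s
    have "DERIV (d 0) s :> d 1 s" if "0 \<le> s" "s \<le> 1" for s
      using has_derivative_compose[OF has_derivative_line f'[OF inU[OF that]]]
      by (simp add: has_field_derivative_def d_def[abs_def] blinfun.scaleR_right mult_commute_abs)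
    moreover have "DERIV (d 1) s :> d 2 s" if "0 \<le> s" "s \<le> 1" for s
    proof -
      have "((\<lambda>s. f' (p + s *\<^sub>R u) u) has_derivative (\<lambda>h. f'' (p + s *\<^sub>R u) (h *\<^sub>R u) u)) (at s)"
        using has_derivative_compose[OF has_derivative_line f''[OF inU[OF that]]]
        by (auto intro!: derivative_eq_intros)
      then show ?thesis
        by (simp add: has_field_derivative_def d_def[abs_def] blinfun.scaleR_right
            blinfun.scaleR_left mult_commute_abs)
    qed
    ultimately have "\<forall>m s. m < 2 \<and> 0 \<le> s \<and> s \<le> 1 \<longrightarrow> DERIV (d m) s :> d (Suc m) s"
      by (metis One_nat_def Suc_1 less_2_cases_iff)
    then obtain s where s: "0 < s" "s < 1"
      and "d 0 1 = (\<Sum>m<2. d m 0 / fact m * 1 ^ m) + d 2 s / fact 2 * 1 ^ 2"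
      using Maclaurin[of 1 2 d "d 0"] by auto
    then have "f (p + u) - f p - f' p u = f'' (p + s *\<^sub>R u) u u / 2"
      by (simp add: d_def numeral_2_eq_2)
    then have "\<bar>f (p + u) - f p - f' p u - f'' p u u / 2\<bar> = \<bar>(f'' (p + s *\<^sub>R u) - f'' p) u u\<bar> / 2"
      by (simp only: blinfun.diff_left flip: diff_divide_distrib) simp
    also have "\<bar>(f'' (p + s *\<^sub>R u) - f'' p) u u\<bar> \<le> norm ((f'' (p + s *\<^sub>R u) - f'' p) u) * norm u"
      using norm_blinfun[of "(f'' (p + s *\<^sub>R u) - f'' p) u" u] by simp
    also have "\<dots> \<le> (norm (f'' (p + s *\<^sub>R u) - f'' p) * norm u) * norm u"
      by (intro mult_right_mono norm_blinfun) auto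
    also have "\<dots> \<le> (\<epsilon> * norm u) * norm u"
      using \<delta>(3)[OF p near[of s]] s by (intro mult_right_mono) (auto simp: dist_norm)
    finally show ?thesis by (simp add: power2_eq_square)
  qed
  show ?thesis
  proof (rule that[OF \<delta>(1)])
    fix p u :: 'a assume "p \<in> K" "norm u < \<delta>"
    then show "\<bar>f (p + u) + f (p - u) - 2 * f p - f'' p u u\<bar> \<le> \<epsilon> * (norm u)\<^sup>2"
      using taylor[of p u] taylor[of p "-u"]
      unfolding blinfun.minus_right blinfun.minus_left norm_minus_cancel minus_minus
        diff_conv_add_uminus[symmetric] by linarith
  qed
qed

section \<open>Averages over spheres\<close>

lemma orthogonal_transformation_borel:
  fixes T :: "'a::euclidean_space \<Rightarrow> 'a"
  assumes "orthogonal_transformation T"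
  shows "T \<in> borel_measurable borel"
  using orthogonal_transformation_linear[OF assms]
  by (intro borel_measurable_continuous_onI linear_continuous_on linear_conv_bounded_linear[THEN iffD1])

text \<open>The image \<open>\<mu>\<close> of Lebesgue measure under \<open>T\<close> is again translation invariant. For two translation
  invariant measures, integrating \<open>indicator A y * indicator B (x - y)\<close> over \<open>x\<close> and \<open>y\<close> in both orders
  gives \<open>\<mu>(A) \<lambda>(B) = \<lambda>(A) \<mu>(- B)\<close>. With the unit ball as \<open>B\<close>, which \<open>T\<close> preserves, the factors cancel
  and \<open>\<mu> = \<lambda>\<close>.\<close>

lemma lborel_distr_orthogonal:
  fixes T :: "'a::euclidean_space \<Rightarrow> 'a"
  assumes T: "orthogonal_transformation T"
  shows "distr lborel borel T = lborel"
proof (rule measure_eqI)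
  note [measurable] = orthogonal_transformation_borel[OF T]
  define \<mu> where "\<mu> = distr lborel borel T"
  have sets_\<mu>[simp, measurable_cong]: "sets \<mu> = sets borel" and space_\<mu>[simp]: "space \<mu> = UNIV"
    by (auto simp: \<mu>_def)
  have transl: "distr \<mu> borel ((+) c) = \<mu>" for c
  proof -
    obtain b where b: "T b = c"
      using orthogonal_transformation_surj[OF T] by (metis surjE)
    have "(+) c \<circ> T = T \<circ> (+) b"
      using orthogonal_transformation_linear[OF T] by (auto simp: linear_add b)
    then have "distr \<mu> borel ((+) c) = distr (distr lborel borel ((+) b)) borel T"
      by (simp add: \<mu>_def distr_distr)
    then show ?thesis by (simp add: lborel_distr_plus \<mu>_def)
  qed
  have ball: "emeasure \<mu> (ball 0 r) = emeasure lborel (ball (0::'a) r)" for r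
  proof -
    have "T -` ball 0 r = ball (0::'a) r"
      using T by (auto simp: orthogonal_transformation_norm)
    then show ?thesis by (simp add: \<mu>_def emeasure_distr)
  qed
  interpret \<mu>: sigma_finite_measure \<mu>
  proof
    show "\<exists>A. countable A \<and> A \<subseteq> sets \<mu> \<and> \<Union> A = space \<mu> \<and> (\<forall>a\<in>A. emeasure \<mu> a \<noteq> \<infinity>)"
    proof (intro exI[of _ "range (\<lambda>n. ball 0 (real n))"] conjI)
      show "\<Union> (range (\<lambda>n. ball (0::'a) (real n))) = space \<mu>"
        using reals_Archimedean2 by auto
      show "\<forall>a\<in>range (\<lambda>n. ball 0 (real n)). emeasure \<mu> a \<noteq> \<infinity>"
        using emeasure_lborel_ball_finite by (auto simp: ball top.not_eq_extremum)
    qed auto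
  qed
  interpret pair_sigma_finite \<mu> "lborel :: 'a measure"
    by unfold_locales
  define B where "B = ball (0::'a) 1"
  have [measurable]: "B \<in> sets borel" by (simp add: B_def)
  define v where "v = emeasure lborel B"
  have v: "v \<noteq> 0" "v \<noteq> \<infinity>"
    using content_ball_pos[of 1 "0::'a"] emeasure_lborel_ball_finite[of "0::'a" 1]
    by (auto simp: v_def B_def measure_def)
  fix A :: "'a set"
  assume "A \<in> sets (distr lborel borel T)"
  then have [measurable]: "A \<in> sets borel" by simp
  have "emeasure \<mu> A * v = (\<integral>\<^sup>+y. (\<integral>\<^sup>+x. indicator A y * indicator B (x - y) \<partial>lborel) \<partial>\<mu>)"
  proof -
    have "(\<integral>\<^sup>+x. indicator B (x - y) \<partial>lborel) = v" for y
    proof -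
      have "(\<integral>\<^sup>+x. indicator B (x - y) \<partial>lborel)
          = (\<integral>\<^sup>+x. indicator B (x - y) \<partial>distr lborel borel ((+) y))"
        by (simp add: lborel_distr_plus)
      also have "\<dots> = (\<integral>\<^sup>+x. indicator B x \<partial>lborel)"
        by (subst nn_integral_distr) auto
      finally show ?thesis by (simp add: v_def)
    qed
    then show ?thesis
      by (simp add: nn_integral_cmult nn_integral_multc)
  qed
  also have "\<dots> = (\<integral>\<^sup>+x. (\<integral>\<^sup>+y. indicator A y * indicator B (x - y) \<partial>\<mu>) \<partial>lborel)"
    by (rule Fubini'[symmetric]) measurable
  also have "\<dots> = (\<integral>\<^sup>+x. (\<integral>\<^sup>+y. indicator A (x + y) * indicator B y \<partial>\<mu>) \<partial>lborel)"
  proof (rule nn_integral_cong)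
    fix x
    have "(\<integral>\<^sup>+y. indicator A y * indicator B (x - y) \<partial>\<mu>)
        = (\<integral>\<^sup>+y. indicator A y * indicator B (x - y) \<partial>distr \<mu> borel ((+) x))"
      by (simp add: transl)
    also have "\<dots> = (\<integral>\<^sup>+y. indicator A (x + y) * indicator B (- y) \<partial>\<mu>)"
      by (subst nn_integral_distr) auto
    also have "(\<lambda>y. indicator B (- y)) = (indicator B :: 'a \<Rightarrow> ennreal)"
      by (auto simp: B_def indicator_def fun_eq_iff)
    finally show "(\<integral>\<^sup>+y. indicator A y * indicator B (x - y) \<partial>\<mu>)
        = (\<integral>\<^sup>+y. indicator A (x + y) * indicator B y \<partial>\<mu>)" by metis
  qed
  also have "\<dots> = (\<integral>\<^sup>+y. (\<integral>\<^sup>+x. indicator A (x + y) * indicator B y \<partial>lborel) \<partial>\<mu>)"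
    by (rule Fubini') measurable
  also have "\<dots> = emeasure lborel A * v"
  proof -
    have "(\<integral>\<^sup>+x. indicator A (x + y) \<partial>lborel) = emeasure lborel A" for y
    proof -
      have "(\<integral>\<^sup>+x. indicator A (x + y) \<partial>lborel) = (\<integral>\<^sup>+x. indicator A x \<partial>distr lborel borel ((+) y))"
        by (subst nn_integral_distr) (auto simp: add.commute)
      then show ?thesis by (simp add: lborel_distr_plus)
    qed
    then show ?thesis
      by (simp add: nn_integral_cmult nn_integral_multc v_def ball[of 1, folded B_def])
  qed
  finally show "emeasure (distr lborel borel T) A = emeasure lborel A"
    using v by (simp add: \<mu>_def ennreal_mult_cancel_left mult.commute[of _ v])
qed simp

text \<open>The radial projection that defines the measure on the sphere commutes with \<open>T\<close>.\<close>

lemma sphere_measure_distr_orthogonal: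
  fixes T :: "'a::euclidean_space \<Rightarrow> 'a"
  assumes T: "orthogonal_transformation T"
  shows "distr (sphere_measure 0 1) borel T = sphere_measure 0 1"
proof -
  note [measurable] = orthogonal_transformation_borel[OF T]
  define P where "P = uniform_measure lborel (ball (0::'a) 1)"
  have [measurable_cong]: "sets P = sets borel" by (simp add: P_def)
  have P: "distr P borel T = P"
  proof (rule measure_eqI)
    fix A :: "'a set" assume "A \<in> sets (distr P borel T)"
    then have [measurable]: "A \<in> sets borel" by simp
    have "T -` ball 0 1 = ball 0 1"
      using T by (auto simp: orthogonal_transformation_norm)
    then have "emeasure lborel (ball 0 1 \<inter> T -` A) = emeasure (distr lborel borel T) (ball 0 1 \<inter> A)"
      by (simp add: emeasure_distr vimage_Int)
    then have "emeasure lborel (ball 0 1 \<inter> T -` A) = emeasure lborel (ball 0 1 \<inter> A)"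
      by (simp add: lborel_distr_orthogonal[OF T])
    moreover have "T -` A \<in> sets borel"
      using measurable_sets[OF orthogonal_transformation_borel[OF T], of A] by simp
    ultimately show "emeasure (distr P borel T) A = emeasure P A"
      by (simp add: emeasure_distr P_def)
  qed (simp add: P_def)
  have [measurable]: "sgn \<in> borel_measurable (borel :: 'a measure)"
    using borel_measurable_sphere_proj[of 0 1] by simp
  have "T \<circ> sgn = sgn \<circ> T"
    using T by (auto simp: sgn_div_norm orthogonal_transformation_norm
        linear_cmul[OF orthogonal_transformation_linear[OF T]])
  then have "distr (distr P borel sgn) borel T = distr (distr P borel T) borel sgn"
    by (simp add: distr_distr)
  then show ?thesis
    by (simp add: P sphere_measure_def P_def[symmetric])
qed

lemma sphere_measure_eq_distr:
  "sphere_measure c r = distr (sphere_measure 0 1) borel (\<lambda>w. c + r *\<^sub>R w)"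
  for c :: "'a::euclidean_space"
proof -
  have [measurable]: "sgn \<in> borel_measurable (borel :: 'a measure)"
    using borel_measurable_sphere_proj[of 0 1] by simp
  show ?thesis
    by (simp add: sphere_measure_def distr_distr o_def)
qed

lemma set_integrable_sphere_measure:
  fixes h :: "'a::euclidean_space \<Rightarrow> real"
  assumes "compact S" "continuous_on S h"
  shows "set_integrable (sphere_measure c r) S h"
proof -
  have [measurable]: "S \<in> sets borel" using assms by (simp add: borel_compact)
  have m: "(\<lambda>x. indicator S x *\<^sub>R h x) \<in> borel_measurable borel"
    by (rule borel_measurable_continuous_on_indicator) (use assms in auto)
  obtain b where b: "\<And>x. x \<in> S \<Longrightarrow> norm (h x) \<le> b"
    using compact_imp_bounded[OF compact_continuous_image[OF assms(2,1)]]
    by (auto simp: bounded_iff)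
  show ?thesis
    unfolding set_integrable_def
  proof (rule integrableI_bounded_set[of S _ _ b])
    show "emeasure (sphere_measure c r) S < \<infinity>"
      using emeasure_mono[of S UNIV "sphere_measure c r"]
      by (simp add: emeasure_sphere_measure_UNIV less_top[symmetric])
       (metis ennreal_one_less_top leD)
  qed (use m b in auto)
qed

definition unit_sphere_average :: "('a::euclidean_space \<Rightarrow> real) \<Rightarrow> real" where
  "unit_sphere_average h = (LINT w:sphere 0 1|sphere_measure 0 1. h w)"

lemma unit_sphere_average_orthogonal:
  fixes T :: "'a::euclidean_space \<Rightarrow> 'a"
  assumes T: "orthogonal_transformation T" and h: "continuous_on (sphere 0 1) h"
  shows "unit_sphere_average (\<lambda>w. h (T w)) = unit_sphere_average h"
proof -
  note [measurable] = orthogonal_transformation_borel[OF T]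
  have "unit_sphere_average h
      = (LINT w|distr (sphere_measure 0 1) borel T. indicator (sphere 0 1) w *\<^sub>R h w)"
    by (simp add: sphere_measure_distr_orthogonal[OF T] unit_sphere_average_def set_lebesgue_integral_def)
  also have "\<dots> = (LINT w|sphere_measure 0 1. indicator (sphere 0 1) (T w) *\<^sub>R h (T w))"
    by (rule integral_distr) (use h in \<open>auto intro!: borel_measurable_continuous_on_indicator simp del: real_scaleR_def\<close>)
  also have "\<dots> = unit_sphere_average (\<lambda>w. h (T w))"
    using T by (simp add: unit_sphere_average_def set_lebesgue_integral_def indicator_def
        orthogonal_transformation_norm)
  finally show ?thesis by simp
qed

lemma integral_sphere_measure_eq_average:
  fixes g :: "'a::euclidean_space \<Rightarrow> real"
  assumes "r > 0" "continuous_on (sphere c r) g"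
  shows "(LINT y:sphere c r|sphere_measure c r. g y) = unit_sphere_average (\<lambda>w. g (c + r *\<^sub>R w))"
proof -
  have "(LINT y:sphere c r|sphere_measure c r. g y)
      = (LINT w|sphere_measure 0 1. indicator (sphere c r) (c + r *\<^sub>R w) *\<^sub>R g (c + r *\<^sub>R w))"
    unfolding set_lebesgue_integral_def sphere_measure_eq_distr[of c r]
    by (rule integral_distr) (use assms in \<open>auto intro!: borel_measurable_continuous_on_indicator simp del: real_scaleR_def\<close>)
  also have "(\<lambda>w. indicator (sphere c r) (c + r *\<^sub>R w)) = (indicator (sphere 0 1) :: 'a \<Rightarrow> real)"
    using assms(1) by (auto simp: fun_eq_iff indicator_def dist_norm)
  finally show ?thesis by (metis (no_types) unit_sphere_average_def set_lebesgue_integral_def)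
qed

lemma unit_sphere_average_const: "unit_sphere_average (\<lambda>w::'a::euclidean_space. a) = a"
proof -
  have "unit_sphere_average (\<lambda>w::'a. a) = (LINT w|sphere_measure (0::'a) 1. a)"
    unfolding unit_sphere_average_def set_lebesgue_integral_def
  proof (rule integral_cong_AE)
    show "AE w in sphere_measure (0::'a) 1. indicator (sphere 0 1) w *\<^sub>R a = a"
      using AE_sphere_measure[OF zero_less_one, of "0::'a"] by eventually_elim simp
  qed (auto intro!: borel_measurable_times borel_measurable_indicator)
  also have "\<dots> = measure (sphere_measure (0::'a) 1) UNIV * a"
    using sets_eq_imp_space_eq[OF sets_sphere_measure[of "0::'a" 1]] by simp
  also have "\<dots> = a"
    by (simp add: measure_def emeasure_sphere_measure_UNIV)
  finally show ?thesis .
qed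

lemma unit_sphere_average_mono:
  fixes h :: "'a::euclidean_space \<Rightarrow> real"
  assumes "continuous_on (sphere 0 1) h" "continuous_on (sphere 0 1) k"
    and "\<And>w. norm w = 1 \<Longrightarrow> h w \<le> k w"
  shows "unit_sphere_average h \<le> unit_sphere_average k"
  unfolding unit_sphere_average_def
  using assms by (intro set_integral_mono set_integrable_sphere_measure) auto

lemma unit_sphere_average_add:
  fixes h :: "'a::euclidean_space \<Rightarrow> real"
  assumes "continuous_on (sphere 0 1) h" "continuous_on (sphere 0 1) k"
  shows "unit_sphere_average (\<lambda>w. h w + k w) = unit_sphere_average h + unit_sphere_average k"
  unfolding unit_sphere_average_def
  using assms by (intro set_integral_add set_integrable_sphere_measure) auto

lemma unit_sphere_average_cmult: "unit_sphere_average (\<lambda>w. a * h w) = a * unit_sphere_average h"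
  unfolding unit_sphere_average_def by simp

lemma unit_sphere_average_sum:
  fixes h :: "'i \<Rightarrow> 'a::euclidean_space \<Rightarrow> real"
  assumes "finite I" "\<And>i. i \<in> I \<Longrightarrow> continuous_on (sphere 0 1) (h i)"
  shows "unit_sphere_average (\<lambda>w. \<Sum>i\<in>I. h i w) = (\<Sum>i\<in>I. unit_sphere_average (h i))"
  using assms
proof (induction I)
  case (insert i I)
  then show ?case by (simp add: unit_sphere_average_add continuous_on_sum)
qed (simp add: unit_sphere_average_const)

section \<open>The quaternionic Hessian and Laplacians on quaternionic lines\<close>

lemma dir_deriv_has_derivative:
  assumes "(g has_derivative g') (at x)"
  shows "dir_deriv u g x = g' u"
proof -
  have "((\<lambda>s. x + s *\<^sub>R u) has_derivative (\<lambda>h. h *\<^sub>R u)) (at 0)"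
    by (rule has_derivative_line)
  from has_derivative_compose[OF this, of g g'] assms
  have "((\<lambda>s. g (x + s *\<^sub>R u)) has_derivative (\<lambda>h. g' (h *\<^sub>R u))) (at 0)"
    by simp
  moreover have "g' (h *\<^sub>R u) = h *\<^sub>R g' u" for h
    using assms by (simp add: has_derivative_def bounded_linear.linear linear_cmul)
  ultimately show ?thesis
    unfolding dir_deriv_def by (intro vector_derivative_at) (simp add: has_vector_derivative_def)
qed

lemma sum_Basis_quat: "(\<Sum>c\<in>Basis. F c) = F 1 + F qi + F qj + F (qk :: quat)"
proof -
  have "1 \<noteq> qi" "1 \<noteq> qj" "1 \<noteq> qk" "qi \<noteq> qj" "qi \<noteq> qk" "qj \<noteq> qk"
    by (simp_all add: quat_eq_iff)
  then show ?thesis by (simp add: Basis_quat_def add.assoc)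
qed

lemma quat_bilinear_expand:
  fixes B :: "quat \<Rightarrow> quat \<Rightarrow> real"
  assumes "bilinear B"
  shows "B p q =
    Qt p * (Qt q * B 1 1 + Qx q * B 1 qi + Qy q * B 1 qj + Qz q * B 1 qk)
  + Qx p * (Qt q * B qi 1 + Qx q * B qi qi + Qy q * B qi qj + Qz q * B qi qk)
  + Qy p * (Qt q * B qj 1 + Qx q * B qj qi + Qy q * B qj qj + Qz q * B qj qk)
  + Qz p * (Qt q * B qk 1 + Qx q * B qk qi + Qy q * B qk qj + Qz q * B qk qk)"
proof -
  have e: "s = Qt s *\<^sub>R 1 + Qx s *\<^sub>R qi + Qy s *\<^sub>R qj + Qz s *\<^sub>R qk" for s
    by (simp add: quat_eq_iff)
  have "B p q = B (Qt p *\<^sub>R 1 + Qx p *\<^sub>R qi + Qy p *\<^sub>R qj + Qz p *\<^sub>R qk)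
      (Qt q *\<^sub>R 1 + Qx q *\<^sub>R qi + Qy q *\<^sub>R qj + Qz q *\<^sub>R qk)"
    using e[of p] e[of q] by simp
  also have "\<dots> = Qt p * (Qt q * B 1 1 + Qx q * B 1 qi + Qy q * B 1 qj + Qz q * B 1 qk)
  + Qx p * (Qt q * B qi 1 + Qx q * B qi qi + Qy q * B qi qj + Qz q * B qi qk)
  + Qy p * (Qt q * B qj 1 + Qx q * B qj qi + Qy q * B qj qj + Qz q * B qj qk)
  + Qz p * (Qt q * B qk 1 + Qx q * B qk qi + Qy q * B qk qj + Qz q * B qk qk)"
    using assms
    by (simp only: bilinear_ladd bilinear_radd bilinear_lmul bilinear_rmul)
       (simp add: algebra_simps)
  finally show ?thesis .
qed

text \<open>For \<open>u \<noteq> 0\<close> the four quaternions \<open>c u\<close>, \<open>c \<in> Basis\<close>, form an orthogonal basis of vectors of length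
  \<open>norm u\<close>, and the trace of a bilinear form can be computed in any orthonormal basis. Applied to a
  second derivative this says that the Laplacian of a function on the quaternions can be
  computed from the second derivatives in the directions \<open>c u\<close>, for every single \<open>u\<close>.\<close>

lemma trace_right_mult:
  fixes B :: "quat \<Rightarrow> quat \<Rightarrow> real"
  assumes "bilinear B"
  shows "(\<Sum>c\<in>Basis. B (c * u) (c * u)) = (norm u)\<^sup>2 * (\<Sum>c\<in>Basis. B c c)"
  unfolding sum_Basis_quat quat_bilinear_expand[OF assms, of "_ * u"]
  by (simp add: norm_quat_def power2_eq_square algebra_simps)

text \<open>The entry \<open>(i, j)\<close> of the quaternionic Hessian, as a function of the real bilinear form
  \<open>B s t = f'' (axis i s) (axis j t)\<close>: the units on the left come from \<open>deriv_qbar i\<close>, the conjugate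
  units on the right from \<open>deriv_q j\<close>.\<close>

definition quat_coeff :: "(quat \<Rightarrow> quat \<Rightarrow> real) \<Rightarrow> quat" where
  "quat_coeff B = (\<Sum>a\<in>Basis. \<Sum>b\<in>Basis. B a b *\<^sub>R (a * qcnj b))"

lemma qcnj_quat_coeff: "qcnj (quat_coeff B) = quat_coeff (\<lambda>a b. B b a)"
  by (simp add: quat_coeff_def sum_Basis_quat quat_eq_iff)

text \<open>The real part of \<open>p\<^sup>* a b\<^sup>* q\<close> (with \<open>\<^sup>*\<close> for the conjugate) is the inner product of \<open>a\<^sup>* p\<close> and
  \<open>b\<^sup>* q\<close>, that is, the sum over \<open>c\<close> in the basis of the products of the \<open>a\<close>-coordinate of \<open>p c\<close> and the
  \<open>b\<close>-coordinate of \<open>q c\<close>. Summing against \<open>B a b\<close> turns coordinates into arguments of \<open>B\<close>.\<close>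

lemma Qt_quat_coeff_sandwich:
  assumes "bilinear B"
  shows "Qt (qcnj p * quat_coeff B * q) = (\<Sum>c\<in>Basis. B (p * c) (q * c))"
  unfolding sum_Basis_quat quat_bilinear_expand[OF assms, of "p * _"]
  by (simp add: quat_coeff_def sum_Basis_quat) (simp add: algebra_simps)

lemma scaleQ_right_add: "scaleQ_right v (p + q) = scaleQ_right v p + scaleQ_right v q"
  by (simp add: scaleQ_right_def vec_eq_iff algebra_simps)

lemma scaleQ_right_scaleR: "scaleQ_right v (c *\<^sub>R p) = c *\<^sub>R scaleQ_right v p"
  by (simp add: scaleQ_right_def vec_eq_iff)

lemma norm_scaleQ_right: "norm (scaleQ_right v p) = norm v * norm p"
  by (simp add: scaleQ_right_def norm_vec_def norm_mult L2_set_left_distrib)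

lemma linear_scaleQ_right: "linear (scaleQ_right v)"
  by (rule linearI) (simp_all add: scaleQ_right_add scaleQ_right_scaleR)

lemma bounded_linear_scaleQ_right: "bounded_linear (scaleQ_right v)"
  by (rule linear_conv_bounded_linear[THEN iffD1, OF linear_scaleQ_right])

lemma scaleQ_right_eq_sum_axis:
  "scaleQ_right v c = (\<Sum>i\<in>UNIV. axis i (v $ i * c))"
  by (simp add: scaleQ_right_def vec_eq_iff axis_def if_distrib cong: if_cong)

lemma bilinear_blinfun2:
  fixes H :: "'a::real_normed_vector \<Rightarrow>\<^sub>L 'a \<Rightarrow>\<^sub>L real" 
  assumes "linear g" "linear h"
  shows "bilinear (\<lambda>s t. H (g s) (h t))"
  unfolding bilinear_def
  by (auto intro!: linearI simp: linear_add[OF assms(1)] linear_add[OF assms(2)]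
      linear_cmul[OF assms(1)] linear_cmul[OF assms(2)] blinfun.bilinear_simps)

lemma linear_axis: "linear (axis i :: 'a::real_vector \<Rightarrow> 'a ^ 'n)"
  by (rule linearI) (simp_all add: vec_eq_iff axis_def)

lemma quat_hessian_eq:
  fixes f :: "quat ^ 'n::finite \<Rightarrow> real"
  assumes "open U" "q \<in> U"
    and f': "\<And>x. x \<in> U \<Longrightarrow> (f has_derivative blinfun_apply (f' x)) (at x)"
    and f'': "(f' has_derivative blinfun_apply H) (at q)"
  shows "quat_hessian f q $ i $ j = quat_coeff (\<lambda>s t. H (axis i s) (axis j t))"
proof -
  define E where "E p = (\<Sum>b\<in>Basis. f' p (axis j b) *\<^sub>R qcnj b)" for p
  have E: "deriv_q j (\<lambda>p. of_real (f p)) p = E p" if "p \<in> U" for p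
  proof -
    have "((\<lambda>p. of_real (f p) :: quat) has_derivative (\<lambda>h. of_real (f' p h))) (at p)"
      using f'[OF that] by (rule has_derivative_of_real)
    then show ?thesis
      unfolding deriv_q_def E_def
      by (simp add: dir_deriv_has_derivative sum_Basis_quat quat_eq_iff)
  qed
  define E' where "E' h = (\<Sum>b\<in>Basis. H h (axis j b) *\<^sub>R qcnj b)" for h
  have "(E has_derivative E') (at q)"
    unfolding E_def[abs_def] E'_def[abs_def]
    by (intro has_derivative_sum has_derivative_scaleR_left bounded_linear.has_derivative[OF blinfun.bounded_linear_left] f'')
  then have "(deriv_q j (\<lambda>p. of_real (f p)) has_derivative E') (at q)"
    by (rule has_derivative_transform_within_open[OF _ assms(1,2)]) (simp add: E)
  then have "quat_hessian f q $ i $ j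
      = E' (axis i 1) + qi * E' (axis i qi) + qj * E' (axis i qj) + qk * E' (axis i qk)"
    by (simp add: quat_hessian_def deriv_qbar_def dir_deriv_has_derivative)
  then show ?thesis
    by (simp add: E'_def quat_coeff_def sum_Basis_quat quat_eq_iff)
qed

lemma quat_real_iff: "p \<in> \<real> \<longleftrightarrow> qcnj p = p" for p :: quat
proof
  assume "qcnj p = p"
  then have "p = of_real (Qt p)" by (simp add: quat_eq_iff)
  then show "p \<in> \<real>" by (metis Reals_of_real)
qed (auto simp: Reals_def quat_eq_iff)

lemma Qt_sum: "Qt (\<Sum>i\<in>A. F i) = (\<Sum>i\<in>A. Qt (F i))"
  by (induction A rule: infinite_finite_induct) auto

lemma qcnj_sum: "qcnj (\<Sum>i\<in>A. F i) = (\<Sum>i\<in>A. qcnj (F i))"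
  by (rule bounded_linear.linear[OF bounded_linear_qcnj, THEN linear_sum])

text \<open>For the second derivative \<open>H\<close> of \<open>f\<close> at \<open>q\<close>, the sum on the right is the Laplacian at \<open>0\<close> of the
  restriction \<open>l \<mapsto> f (q + v l)\<close> to a quaternionic line. It equals the value at \<open>v\<close> of the form with
  matrix \<open>A\<close>, a real number because \<open>A\<close> is hyperhermitian.\<close>

lemma nonneg_definite_iff_traces_nonneg:
  fixes A :: "quat ^ 'n::finite ^ 'n" and H :: "(quat ^ 'n) \<Rightarrow>\<^sub>L (quat ^ 'n) \<Rightarrow>\<^sub>L real"
  assumes A: "\<And>i j. A $ i $ j = quat_coeff (\<lambda>s t. H (axis i s) (axis j t))"
    and sym: "\<And>u w. H u w = H w u"
  shows "nonneg_definite A \<longleftrightarrow>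
    (\<forall>v. 0 \<le> (\<Sum>c\<in>Basis. H (scaleQ_right v c) (scaleQ_right v c)))"
proof -
  have herm: "hyperhermitian A"
    unfolding hyperhermitian_def by (simp add: A qcnj_quat_coeff sym)
  define P where "P x = (\<Sum>i\<in>UNIV. \<Sum>j\<in>UNIV. qcnj (x $ i) * A $ i $ j * x $ j)" for x
  have "qcnj (P x) = P x" for x
  proof -
    have "qcnj (P x) = (\<Sum>i\<in>UNIV. \<Sum>j\<in>UNIV. qcnj (qcnj (x $ i) * A $ i $ j * x $ j))"
      by (simp add: P_def qcnj_sum)
    also have "\<dots> = (\<Sum>i\<in>UNIV. \<Sum>j\<in>UNIV. qcnj (x $ j) * A $ j $ i * x $ i)"
    proof (intro sum.cong refl)
      fix i j
      have "qcnj (A $ i $ j) = A $ j $ i"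
        using herm by (metis hyperhermitian_def)
      moreover have "qcnj (qcnj (x $ i)) = x $ i" by (simp add: quat_eq_iff)
      ultimately show "qcnj (qcnj (x $ i) * A $ i $ j * x $ j) = qcnj (x $ j) * A $ j $ i * x $ i"
        by (simp add: qcnj_mult mult.assoc)
    qed
    also have "\<dots> = P x" unfolding P_def by (rule sum.swap)
    finally show ?thesis .
  qed
  moreover have "Qt (P v) = (\<Sum>c\<in>Basis. H (scaleQ_right v c) (scaleQ_right v c))" for v
  proof -
    have "Qt (P v) = (\<Sum>i\<in>UNIV. \<Sum>j\<in>UNIV. \<Sum>c\<in>Basis. H (axis i (v $ i * c)) (axis j (v $ j * c)))"
      by (simp only: P_def Qt_sum A Qt_quat_coeff_sandwich[OF bilinear_blinfun2[OF linear_axis linear_axis]])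
    also have "\<dots> = (\<Sum>c\<in>Basis. \<Sum>i\<in>UNIV. \<Sum>j\<in>UNIV. H (axis i (v $ i * c)) (axis j (v $ j * c)))"
      by (rule trans[OF sum.cong[OF refl sum.swap] sum.swap])
    also have "\<dots> = (\<Sum>c\<in>Basis. H (scaleQ_right v c) (scaleQ_right v c))"
      by (simp add: scaleQ_right_eq_sum_axis blinfun.sum_left blinfun.sum_right)
         (rule sum.cong[OF refl sum.swap])
    finally show ?thesis .
  qed
  ultimately show ?thesis
    using herm by (simp add: nonneg_definite_def Let_def quat_real_iff P_def[symmetric])
qed

section \<open>Spherical means and the maximum principle on the quaternions\<close>

lemma orthogonal_transformation_quat_mult:
  "norm u = 1 \<Longrightarrow> orthogonal_transformation ((*) (u::quat))"
  by (simp add: orthogonal_transformation norm_mult bounded_linear_mult_right bounded_linear.linear)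

text \<open>The quaternion \<open>l\<close> may be chosen freely among those of norm \<open>r\<close> because left multiplication by a
  unit quaternion is an isometry. This freedom makes \<open>l \<mapsto> unit_sphere_average (\<lambda>w. g (c + l * w))\<close> a
  radial function whose value for \<open>norm l = r\<close> is the mean of \<open>g\<close> over the sphere of radius \<open>r\<close>.\<close>

lemma integral_sphere_measure_eq_average_quat:
  fixes g :: "quat \<Rightarrow> real"
  assumes "r > 0" "continuous_on (sphere c r) g" "norm l = r"
  shows "(LINT y:sphere c r|sphere_measure c r. g y) = unit_sphere_average (\<lambda>w. g (c + l * w))"
proof -
  define u where "u = l /\<^sub>R r"
  have u: "norm u = 1" and ru: "r *\<^sub>R (u * w) = l * w" for w
    using assms by (auto simp: u_def)
  have "continuous_on (sphere 0 1) (\<lambda>w. g (c + r *\<^sub>R w))"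
    by (rule continuous_on_compose2[OF assms(2)])
       (use assms in \<open>auto intro!: continuous_intros simp: dist_norm\<close>)
  from unit_sphere_average_orthogonal[OF orthogonal_transformation_quat_mult[OF u] this]
  show ?thesis
    by (simp add: integral_sphere_measure_eq_average[OF assms(1,2)] ru)
qed

lemma continuous_on_rotation_orbit:
  fixes g :: "quat \<Rightarrow> real"
  assumes "continuous_on (sphere x (norm l)) g"
  shows "continuous_on (sphere 0 1) (\<lambda>w. g (x + l * w))"
  by (rule continuous_on_compose2[OF assms])
     (auto intro!: continuous_intros simp: dist_norm norm_mult)

text \<open>By distributivity \<open>(l + h c) w = l w + c (h w)\<close>: a second difference of the average in the direction
  \<open>c\<close> is the average of second differences of \<open>g\<close> in the directions \<open>c (h w)\<close>. For fixed \<open>w\<close> these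
  directions, with \<open>c\<close> running through the basis, are orthogonal, so that the integrand is a discrete
  Laplacian of \<open>g\<close>.\<close>

lemma sum_second_difference_sphere_average:
  fixes g :: "quat \<Rightarrow> real"
  assumes g: "continuous_on (cball x r) g"
    and l: "norm l \<le> r" "\<And>c. c \<in> Basis \<Longrightarrow> norm (l + h *\<^sub>R c) \<le> r \<and> norm (l - h *\<^sub>R c) \<le> r"
  defines "A \<equiv> \<lambda>l. unit_sphere_average (\<lambda>w. g (x + l * w))"
  shows "(\<Sum>c\<in>Basis. A (l + h *\<^sub>R c) + A (l - h *\<^sub>R c) - 2 * A l)
    = unit_sphere_average (\<lambda>w. \<Sum>c\<in>Basis. g (x + l * w + c * (h *\<^sub>R w))
        + g (x + l * w - c * (h *\<^sub>R w)) - 2 * g (x + l * w))"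
    and "continuous_on (sphere 0 1) (\<lambda>w. \<Sum>c\<in>Basis. g (x + l * w + c * (h *\<^sub>R w))
        + g (x + l * w - c * (h *\<^sub>R w)) - 2 * g (x + l * w))"
proof -
  have cont: "continuous_on (sphere 0 1) (\<lambda>w. g (x + k * w))" if "norm k \<le> r" for k
    by (rule continuous_on_rotation_orbit, rule continuous_on_subset[OF g]) (use that in auto)
  have eq: "g (x + l * w + c * (h *\<^sub>R w)) = g (x + (l + h *\<^sub>R c) * w)"
    "g (x + l * w - c * (h *\<^sub>R w)) = g (x + (l - h *\<^sub>R c) * w)" for c w
    by (simp_all add: algebra_simps)
  have neg: "- 2 * A l = unit_sphere_average (\<lambda>w. - 2 * g (x + l * w))"
    unfolding A_def by (rule unit_sphere_average_cmult[symmetric])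
  have c2: "continuous_on (sphere 0 1) (\<lambda>w. - 2 * g (x + l * w))"
    by (intro continuous_intros cont l)
  have c3: "continuous_on (sphere 0 1) (\<lambda>w. g (x + (l + h *\<^sub>R c) * w) + g (x + (l - h *\<^sub>R c) * w))"
    if "c \<in> Basis" for c
    using cont l that by (intro continuous_on_add) auto
  have c4: "continuous_on (sphere 0 1)
      (\<lambda>w. g (x + (l + h *\<^sub>R c) * w) + g (x + (l - h *\<^sub>R c) * w) + - 2 * g (x + l * w))"
    if "c \<in> Basis" for c
    using continuous_on_add[OF c3[OF that] c2] .
  have *: "A (l + h *\<^sub>R c) + A (l - h *\<^sub>R c) + - 2 * A l = unit_sphere_average
      (\<lambda>w. g (x + (l + h *\<^sub>R c) * w) + g (x + (l - h *\<^sub>R c) * w) + - 2 * g (x + l * w))"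
    if "c \<in> Basis" for c
    unfolding neg using cont l that
    by (simp only: unit_sphere_average_add[OF c3[OF that] c2] unit_sphere_average_add A_def)
  show "continuous_on (sphere 0 1) (\<lambda>w. \<Sum>c\<in>Basis. g (x + l * w + c * (h *\<^sub>R w))
        + g (x + l * w - c * (h *\<^sub>R w)) - 2 * g (x + l * w))"
    unfolding eq using c4 by (intro continuous_on_sum) simp
  show "(\<Sum>c\<in>Basis. A (l + h *\<^sub>R c) + A (l - h *\<^sub>R c) - 2 * A l)
    = unit_sphere_average (\<lambda>w. \<Sum>c\<in>Basis. g (x + l * w + c * (h *\<^sub>R w))
        + g (x + l * w - c * (h *\<^sub>R w)) - 2 * g (x + l * w))"
    unfolding eq using c4 * by (subst unit_sphere_average_sum) auto
qed

text \<open>Each of the eight quaternions \<open>l = r c\<close>, \<open>l = - r c\<close> represents the spherical mean as the average of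
  \<open>g (x + l w)\<close>. Adding the eight formulas produces an average of discrete Laplacians at \<open>x\<close>.\<close>

lemma sphere_mean_le_second_difference:
  fixes g :: "quat \<Rightarrow> real"
  assumes r: "r > 0" and g: "continuous_on (cball x r) g"
    and diff: "\<And>u. norm u = r \<Longrightarrow> (\<Sum>c\<in>Basis. g (x + c * u) + g (x - c * u) - 2 * g x) \<le> K"
  shows "8 * ((LINT y:sphere x r|sphere_measure x r. g y) - g x) \<le> K"
proof -
  define M where "M = (LINT y:sphere x r|sphere_measure x r. g y)"
  have "continuous_on (sphere x r) g"
    by (rule continuous_on_subset[OF g]) auto
  then have M: "unit_sphere_average (\<lambda>w. g (x + l * w)) = M" if "norm l = r" for l
    using integral_sphere_measure_eq_average_quat[OF r _ that] by (simp add: M_def)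
  have rc: "norm (r *\<^sub>R c) = r" "norm (- (r *\<^sub>R c)) = r" if "c \<in> Basis" for c :: quat
    using r that by auto
  have "8 * (M - g x) = (\<Sum>c\<in>(Basis::quat set). M + M - 2 * g x)"
    by (simp add: sum_Basis_quat)
  also have "\<dots> = (\<Sum>c\<in>Basis. unit_sphere_average (\<lambda>w. g (x + (0 + r *\<^sub>R c) * w))
      + unit_sphere_average (\<lambda>w. g (x + (0 - r *\<^sub>R c) * w)) - 2 * unit_sphere_average (\<lambda>w. g (x + 0 * w)))"
  proof (rule sum.cong[OF refl])
    fix c :: quat assume "c \<in> Basis"
    with rc have "norm (0 + r *\<^sub>R c) = r" "norm (0 - r *\<^sub>R c) = r" by auto
    then show "M + M - 2 * g x = unit_sphere_average (\<lambda>w. g (x + (0 + r *\<^sub>R c) * w))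
        + unit_sphere_average (\<lambda>w. g (x + (0 - r *\<^sub>R c) * w)) - 2 * unit_sphere_average (\<lambda>w. g (x + 0 * w))"
      by (simp only: M mult_zero_left add_0_right unit_sphere_average_const)
  qed
  also have "\<dots> = unit_sphere_average (\<lambda>w. \<Sum>c\<in>Basis. g (x + 0 * w + c * (r *\<^sub>R w))
        + g (x + 0 * w - c * (r *\<^sub>R w)) - 2 * g (x + 0 * w))"
    using r rc by (intro sum_second_difference_sphere_average(1)[OF g]) auto
  also have "\<dots> \<le> unit_sphere_average (\<lambda>w::quat. K)"
  proof (rule unit_sphere_average_mono)
    show "continuous_on (sphere 0 1) (\<lambda>w. \<Sum>c\<in>Basis. g (x + 0 * w + c * (r *\<^sub>R w))
        + g (x + 0 * w - c * (r *\<^sub>R w)) - 2 * g (x + 0 * w))"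
      using r rc by (intro sum_second_difference_sphere_average(2)[OF g]) auto
    show "(\<Sum>c\<in>Basis. g (x + 0 * w + c * (r *\<^sub>R w)) + g (x + 0 * w - c * (r *\<^sub>R w))
        - 2 * g (x + 0 * w)) \<le> K" if "norm w = 1" for w
      using diff[of "r *\<^sub>R w"] r that by simp
  qed simp
  finally show ?thesis by (simp add: unit_sphere_average_const M_def)
qed

lemma continuous_on_unit_sphere_average:
  fixes g :: "quat \<Rightarrow> real"
  assumes g: "continuous_on (cball x r) g"
  shows "continuous_on (cball 0 r) (\<lambda>l. unit_sphere_average (\<lambda>w. g (x + l * w)))"
  unfolding continuous_on_iff
proof (intro ballI allI impI)
  fix l :: quat and e :: real
  assume l: "l \<in> cball 0 r" and e: "0 < e"
  have cont: "continuous_on (sphere 0 1) (\<lambda>w. g (x + k * w))" if "k \<in> cball 0 r" for k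
    by (rule continuous_on_rotation_orbit, rule continuous_on_subset[OF g]) (use that in auto)
  have half: "e / 2 > 0" using e by simp
  have "uniformly_continuous_on (cball x r) g"
    by (rule compact_uniformly_continuous[OF g]) simp
  then obtain d where d: "d > 0"
    "\<And>y z. y \<in> cball x r \<Longrightarrow> z \<in> cball x r \<Longrightarrow> dist z y < d \<Longrightarrow> dist (g z) (g y) < e / 2"
    unfolding uniformly_continuous_on_def using half by metis
  have close: "unit_sphere_average (\<lambda>w. g (x + a * w)) \<le> unit_sphere_average (\<lambda>w. g (x + b * w)) + e / 2"
    if "a \<in> cball 0 r" "b \<in> cball 0 r" "dist a b < d" for a b
  proof -
    have "unit_sphere_average (\<lambda>w. g (x + a * w)) \<le> unit_sphere_average (\<lambda>w. g (x + b * w) + e / 2)"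
    proof (rule unit_sphere_average_mono)
      fix w :: quat assume w: "norm w = 1"
      have "dist (x + a * w) (x + b * w) = norm ((a - b) * w)"
        by (simp add: dist_norm algebra_simps)
      also have "\<dots> < d" using that w by (simp add: norm_mult dist_norm)
      finally have "dist (g (x + a * w)) (g (x + b * w)) < e / 2"
        using that w by (intro d(2)) (auto simp: dist_norm norm_mult)
      then show "g (x + a * w) \<le> g (x + b * w) + e / 2"
        unfolding dist_real_def by linarith
    qed (intro continuous_intros cont that)+
    also have "\<dots> = unit_sphere_average (\<lambda>w. g (x + b * w)) + e / 2"
      by (subst unit_sphere_average_add) (auto simp: unit_sphere_average_const intro!: cont that)
    finally show ?thesis .
  qed
  show "\<exists>d>0. \<forall>k\<in>cball 0 r. dist k l < d \<longrightarrow>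
      dist (unit_sphere_average (\<lambda>w. g (x + k * w))) (unit_sphere_average (\<lambda>w. g (x + l * w))) < e"
  proof (intro exI[of _ d] conjI ballI impI d)
    fix k assume "k \<in> cball 0 r" "dist k l < d"
    then show "dist (unit_sphere_average (\<lambda>w. g (x + k * w))) (unit_sphere_average (\<lambda>w. g (x + l * w))) < e"
      using close[of k l] close[of l k] l half by (simp add: dist_real_def dist_commute)
  qed
qed

text \<open>The hypothesis is a discrete form of \<open>\<Delta> g \<ge> 0\<close>, and the conclusion follows from the maximum
  principle. If the mean \<open>M\<close> were less than \<open>g x\<close>, then for small \<open>\<epsilon>\<close> the radial function
  \<open>G l = unit_sphere_average (\<lambda>w. g (x + l * w)) + \<epsilon> (norm l)\<^sup>2\<close> would be smaller on the sphere of radius \<open>r\<close>,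
  where it is \<open>M + \<epsilon> r\<^sup>2\<close>, than at the centre, where it is \<open>g x\<close>. So \<open>G\<close> would have a maximum in the open
  ball, where its second differences are at most \<open>0\<close>; but the term \<open>\<epsilon> (norm l)\<^sup>2\<close> makes their sum
  positive.\<close>

lemma sub_mean_value:
  fixes g :: "quat \<Rightarrow> real"
  assumes r: "r > 0" and g: "continuous_on (cball x r) g"
    and diff: "\<And>\<eta>. \<eta> > 0 \<Longrightarrow> \<exists>\<delta>>0. \<forall>p\<in>cball x r. \<forall>u. norm u < \<delta> \<longrightarrow>
      - \<eta> * (norm u)\<^sup>2 \<le> (\<Sum>c\<in>Basis. g (p + c * u) + g (p - c * u) - 2 * g p)"
  shows "g x \<le> (LINT y:sphere x r|sphere_measure x r. g y)"
proof (rule ccontr)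
  define M where "M = (LINT y:sphere x r|sphere_measure x r. g y)"
  assume "\<not> ?thesis"
  then have less: "M < g x" by (simp add: M_def)
  (* Any positive value with \<epsilon> r^2 < g x - M would do. *)
  define \<epsilon> where "\<epsilon> = (g x - M) / (2 * r\<^sup>2)"
  have \<epsilon>: "\<epsilon> > 0" "\<epsilon> * r\<^sup>2 < g x - M"
    using less r by (auto simp: \<epsilon>_def)
  define A where "A l = unit_sphere_average (\<lambda>w. g (x + l * w))" for l
  define G where "G l = A l + \<epsilon> * (norm l)\<^sup>2" for l
  have "continuous_on (cball 0 r) G"
    unfolding G_def[abs_def] A_def
    by (intro continuous_intros continuous_on_unit_sphere_average g)
  then obtain l where l: "norm l \<le> r" and max: "\<And>k. norm k \<le> r \<Longrightarrow> G k \<le> G l"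
    using continuous_attains_sup[of "cball 0 r" G] r by auto
  have "norm l \<noteq> r"
  proof
    assume "norm l = r"
    moreover have "continuous_on (sphere x r) g"
      by (rule continuous_on_subset[OF g]) auto
    ultimately have "A l = M"
      using integral_sphere_measure_eq_average_quat[OF r] by (simp add: A_def M_def)
    then have "G l < G 0"
      using \<epsilon> \<open>norm l = r\<close> by (simp add: G_def A_def unit_sphere_average_const)
    then show False using max[of 0] r by simp
  qed
  then have lr: "norm l < r" using l by simp
  obtain \<delta> where \<delta>: "\<delta> > 0" "\<And>p u. p \<in> cball x r \<Longrightarrow> norm u < \<delta> \<Longrightarrow>
      - \<epsilon> * (norm u)\<^sup>2 \<le> (\<Sum>c\<in>Basis. g (p + c * u) + g (p - c * u) - 2 * g p)"
    using diff[OF \<epsilon>(1)] by blast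
  define h where "h = min \<delta> (r - norm l) / 2"
  have h: "h > 0" "h < \<delta>" "norm l + h \<le> r"
    using \<delta>(1) lr by (auto simp: h_def min_def field_simps)
  have near: "norm (l + h *\<^sub>R c) \<le> r \<and> norm (l - h *\<^sub>R c) \<le> r" if "c \<in> Basis" for c
    using norm_triangle_ineq[of l "h *\<^sub>R c"] norm_triangle_ineq4[of l "h *\<^sub>R c"] h that by auto
  have "A (l + h *\<^sub>R c) + A (l - h *\<^sub>R c) - 2 * A l \<le> - 2 * \<epsilon> * h\<^sup>2" if "c \<in> Basis" for c
  proof -
    (* Each pair of neighbours raises the quadratic term by 2 \<epsilon> h^2; the four pairs together
       outweigh the error \<epsilon> h^2 that the hypothesis on g allows. *)
    have "(norm (l + h *\<^sub>R c))\<^sup>2 + (norm (l - h *\<^sub>R c))\<^sup>2 - 2 * (norm l)\<^sup>2 = 2 * h\<^sup>2"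
      unfolding power2_norm_eq_inner using that
      by (simp add: inner_simps inner_commute power2_eq_square)
    then have "\<epsilon> * (norm (l + h *\<^sub>R c))\<^sup>2 + \<epsilon> * (norm (l - h *\<^sub>R c))\<^sup>2 - 2 * (\<epsilon> * (norm l)\<^sup>2)
        = 2 * \<epsilon> * h\<^sup>2"
      by algebra
    moreover have "G (l + h *\<^sub>R c) \<le> G l" "G (l - h *\<^sub>R c) \<le> G l"
      using max near[OF that] by auto
    ultimately show ?thesis by (simp add: G_def)
  qed
  then have "(\<Sum>c\<in>Basis. A (l + h *\<^sub>R c) + A (l - h *\<^sub>R c) - 2 * A l)
      \<le> (\<Sum>c\<in>(Basis::quat set). - 2 * \<epsilon> * h\<^sup>2)"
    by (rule sum_mono)
  also have "\<dots> = - 8 * \<epsilon> * h\<^sup>2" by (simp add: sum_Basis_quat)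
  also have "\<dots> < - \<epsilon> * h\<^sup>2" using \<epsilon>(1) h(1) by simp
  also have "\<dots> = unit_sphere_average (\<lambda>w::quat. - \<epsilon> * h\<^sup>2)" by (rule unit_sphere_average_const[symmetric])
  also have "\<dots> \<le> unit_sphere_average (\<lambda>w. \<Sum>c\<in>Basis. g (x + l * w + c * (h *\<^sub>R w))
        + g (x + l * w - c * (h *\<^sub>R w)) - 2 * g (x + l * w))"
  proof (rule unit_sphere_average_mono)
    show "- \<epsilon> * h\<^sup>2 \<le> (\<Sum>c\<in>Basis. g (x + l * w + c * (h *\<^sub>R w))
        + g (x + l * w - c * (h *\<^sub>R w)) - 2 * g (x + l * w))" if "norm w = 1" for w
      using \<delta>(2)[of "x + l * w" "h *\<^sub>R w"] that h l by (simp add: norm_mult dist_norm)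
  qed (simp, rule sum_second_difference_sphere_average(2)[OF g l near])
  also have "\<dots> = (\<Sum>c\<in>Basis. A (l + h *\<^sub>R c) + A (l - h *\<^sub>R c) - 2 * A l)"
    unfolding A_def by (rule sum_second_difference_sphere_average(1)[OF g l near, symmetric])
  finally show False by simp
qed

section \<open>Plurisubharmonicity\<close>

lemma usc_on_continuous: "continuous_on U f \<Longrightarrow> usc_on U f"
proof -
  assume "continuous_on U f"
  then have "openin (top_of_set U) (U \<inter> f -` {..<c})" for c
    by (intro continuous_openin_preimage_gen) auto
  moreover have "{x \<in> U. f x < c} = U \<inter> f -` {..<c}" for c by auto
  ultimately show ?thesis by (simp add: usc_on_def)
qed

text \<open>\<open>L p\<close> is the Laplacian of \<open>g\<close> at \<open>p\<close>. The second order terms of \<open>f\<close> in the four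
  directions \<open>v (c u)\<close> add up to exactly \<open>(norm u)\<^sup>2 * L p\<close>, by \<open>trace_right_mult\<close>.\<close>

lemma line_second_difference_uniform:
  fixes f :: "quat ^ 'n::finite \<Rightarrow> real"
    and f' :: "quat ^ 'n \<Rightarrow> (quat ^ 'n) \<Rightarrow>\<^sub>L real"
    and f'' :: "quat ^ 'n \<Rightarrow> (quat ^ 'n) \<Rightarrow>\<^sub>L (quat ^ 'n) \<Rightarrow>\<^sub>L real"
  assumes "open U"
    and f': "\<And>x. x \<in> U \<Longrightarrow> (f has_derivative blinfun_apply (f' x)) (at x)"
    and f'': "\<And>x. x \<in> U \<Longrightarrow> (f' has_derivative blinfun_apply (f'' x)) (at x)"
    and "continuous_on U f''" "compact K" "\<And>p. p \<in> K \<Longrightarrow> a + scaleQ_right v p \<in> U" "\<eta> > 0"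
  defines "g \<equiv> \<lambda>p. f (a + scaleQ_right v p)"
    and "L \<equiv> \<lambda>p. \<Sum>c\<in>Basis. f'' (a + scaleQ_right v p) (scaleQ_right v c) (scaleQ_right v c)"
  obtains \<delta> where "\<delta> > 0"
    "\<And>p u :: quat. p \<in> K \<Longrightarrow> norm u < \<delta> \<Longrightarrow>
      \<bar>(\<Sum>c\<in>Basis. g (p + c * u) + g (p - c * u) - 2 * g p) - (norm u)\<^sup>2 * L p\<bar> \<le> \<eta> * (norm u)\<^sup>2"
proof -
  (* Bounds norm v and is positive also for v = 0. *)
  define V where "V = 1 + norm v"
  have V: "V > 0" "norm v \<le> V" by (auto simp: V_def add_pos_nonneg)
  (* A quarter for each of the four directions, whose lengths are at most V * norm u. *)
  define \<epsilon> where "\<epsilon> = \<eta> / (4 * V\<^sup>2)"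
  have \<epsilon>: "\<epsilon> > 0" using V \<open>\<eta> > 0\<close> by (simp add: \<epsilon>_def)
  define K' where "K' = (\<lambda>p. a + scaleQ_right v p) ` K"
  have "compact K'"
    unfolding K'_def using \<open>compact K\<close>
    by (intro compact_continuous_image continuous_intros
        linear_continuous_on[OF bounded_linear_scaleQ_right])
  moreover have "K' \<subseteq> U" using assms(6) by (auto simp: K'_def)
  ultimately obtain \<delta> where \<delta>: "\<delta> > 0"
    "\<And>p u. p \<in> K' \<Longrightarrow> norm u < \<delta> \<Longrightarrow>
      \<bar>f (p + u) + f (p - u) - 2 * f p - f'' p u u\<bar> \<le> \<epsilon> * (norm u)\<^sup>2"
    using second_difference_uniform[OF assms(1) f' f'' assms(4) _ _ \<epsilon>] by blast
  show ?thesis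
  proof (rule that[of "\<delta> / V"])
    show "\<delta> / V > 0" using \<delta> V by simp
    fix p u :: quat assume p: "p \<in> K" and u: "norm u < \<delta> / V"
    have diff_add_eq_2: "a + (y - z) = (a + y) - z" for y z :: "quat ^ 'n" by simp
    define D where "D c = g (p + c * u) + g (p - c * u) - 2 * g p
        - f'' (a + scaleQ_right v p) (scaleQ_right v (c * u)) (scaleQ_right v (c * u))" for c
    have D: "\<bar>D c\<bar> \<le> \<eta> * (norm u)\<^sup>2 / 4" if c: "c \<in> Basis" for c
    proof -
      have n: "norm (scaleQ_right v (c * u)) = norm v * norm u"
        using c by (simp add: norm_scaleQ_right norm_mult)
      have le: "norm v * norm u \<le> V * norm u" using V by (intro mult_right_mono) auto
      have "V * norm u < \<delta>" using u V by (simp add: field_simps)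
      then have "norm (scaleQ_right v (c * u)) < \<delta>" using n le by simp
      then have "\<bar>D c\<bar> \<le> \<epsilon> * (norm (scaleQ_right v (c * u)))\<^sup>2"
        using \<delta>(2)[of "a + scaleQ_right v p" "scaleQ_right v (c * u)"] p
        by (simp add: D_def g_def K'_def scaleQ_right_add add.assoc[symmetric]
            linear_diff[OF linear_scaleQ_right] diff_add_eq_2)
      also have "\<dots> \<le> \<epsilon> * (V * norm u)\<^sup>2"
        unfolding n using le \<epsilon> by (intro mult_left_mono power_mono) auto
      also have "\<dots> = \<eta> * (norm u)\<^sup>2 / 4"
        using V by (simp add: \<epsilon>_def power_mult_distrib)
      finally show ?thesis .
    qed
    have "(norm u)\<^sup>2 * L p = (\<Sum>c\<in>Basis. f'' (a + scaleQ_right v p) (scaleQ_right v (c * u)) (scaleQ_right v (c * u)))"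
      unfolding L_def
      by (rule trace_right_mult[OF bilinear_blinfun2[OF linear_scaleQ_right linear_scaleQ_right], symmetric])
    then have "(\<Sum>c\<in>Basis. g (p + c * u) + g (p - c * u) - 2 * g p) - (norm u)\<^sup>2 * L p = (\<Sum>c\<in>Basis. D c)"
      by (simp add: D_def sum_subtractf)
    also have "\<bar>\<dots>\<bar> \<le> (\<Sum>c\<in>Basis. \<bar>D c\<bar>)" by (rule sum_abs)
    also have "\<dots> \<le> (\<Sum>c\<in>(Basis::quat set). \<eta> * (norm u)\<^sup>2 / 4)" by (rule sum_mono[OF D])
    also have "\<dots> = \<eta> * (norm u)\<^sup>2" by (simp add: sum_Basis_quat)
    finally show "\<bar>(\<Sum>c\<in>Basis. g (p + c * u) + g (p - c * u) - 2 * g p) - (norm u)\<^sup>2 * L p\<bar>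
        \<le> \<eta> * (norm u)\<^sup>2" .
  qed
qed

theorem proposition2p1p6:
  fixes \<Omega> :: "(quat ^ 'n::finite) set" and f :: "quat ^ 'n \<Rightarrow> real"
  assumes "open \<Omega>" and "C2_on \<Omega> f"
  shows "quat_psh_on \<Omega> f \<longleftrightarrow> (\<forall>q\<in>\<Omega>. nonneg_definite (quat_hessian f q))"
proof -
  obtain f' :: "quat ^ 'n \<Rightarrow> (quat ^ 'n) \<Rightarrow>\<^sub>L real"
    and f'' :: "quat ^ 'n \<Rightarrow> (quat ^ 'n) \<Rightarrow>\<^sub>L (quat ^ 'n) \<Rightarrow>\<^sub>L real"
    where f': "\<And>x. x \<in> \<Omega> \<Longrightarrow> (f has_derivative blinfun_apply (f' x)) (at x)"
      and f'': "\<And>x. x \<in> \<Omega> \<Longrightarrow> (f' has_derivative blinfun_apply (f'' x)) (at x)"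
      and cont: "continuous_on \<Omega> f''"
    using assms(2) unfolding C2_on_def by blast
  (* The Laplacian at l = 0 of the restriction of f to the line q + v l. *)
  define L where "L q v = (\<Sum>c\<in>Basis. f'' q (scaleQ_right v c) (scaleQ_right v c))" for q v
  have nonneg_iff: "nonneg_definite (quat_hessian f q) \<longleftrightarrow> (\<forall>v. 0 \<le> L q v)" if "q \<in> \<Omega>" for q
    unfolding L_def
    by (intro nonneg_definite_iff_traces_nonneg quat_hessian_eq[OF assms(1) that f' f''[OF that]]
        second_derivative_symmetric[OF assms(1) that f' f''[OF that]])
  have cont_f: "continuous_on \<Omega> f"
    using f' by (intro continuous_at_imp_continuous_on) (auto intro: has_derivative_continuous)
  define S where "S a v = {l. a + scaleQ_right v l \<in> \<Omega>}" for a v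
  define g where "g a v l = f (a + scaleQ_right v l)" for a v l
  have cont_line: "continuous_on X (\<lambda>l. a + scaleQ_right v l)" for a v X
    by (intro continuous_intros linear_continuous_on[OF bounded_linear_scaleQ_right])
  have open_S: "open (S a v)" for a v
    using open_vimage[OF assms(1) cont_line[of UNIV a v]] by (simp add: S_def vimage_def)
  have cont_g: "continuous_on (S a v) (g a v)" for a v
    unfolding g_def[abs_def] by (rule continuous_on_compose2[OF cont_f cont_line]) (auto simp: S_def)
  note second_difference = line_second_difference_uniform[OF assms(1) f' f'' cont,
      folded L_def g_def]
  show ?thesis
  proof
    assume psh: "quat_psh_on \<Omega> f"
    show "\<forall>q\<in>\<Omega>. nonneg_definite (quat_hessian f q)"
    proof
      fix q assume q: "q \<in> \<Omega>"
      have "0 \<le> L q v" for v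
      proof (cases "v = 0")
        case True
        then have "scaleQ_right v c = 0" for c by (simp add: scaleQ_right_def vec_eq_iff)
        then show ?thesis by (simp add: L_def)
      next
        case False
        show ?thesis
        proof (rule ccontr)
          assume "\<not> 0 \<le> L q v"
          (* Half of the negative Laplacian may be spent on the error of the second differences. *)
          define \<eta> where "\<eta> = - L q v / 2"
          have \<eta>: "\<eta> > 0" "L q v = - 2 * \<eta>" using \<open>\<not> 0 \<le> L q v\<close> by (auto simp: \<eta>_def)
          have zero: "0 \<in> S q v" "scaleQ_right v 0 = 0"
            using q by (simp_all add: S_def linear_0[OF linear_scaleQ_right])
          obtain \<delta> where \<delta>: "\<delta> > 0" "\<And>u :: quat. norm u < \<delta> \<Longrightarrow>
              \<bar>(\<Sum>c\<in>Basis. g q v (0 + c * u) + g q v (0 - c * u) - 2 * g q v 0)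
                - (norm u)\<^sup>2 * L (q + scaleQ_right v 0) v\<bar> \<le> \<eta> * (norm u)\<^sup>2"
            by (rule second_difference[of "{0}" q v \<eta>]) (use q zero \<eta> in auto)
          obtain R where R: "R > 0" "cball 0 R \<subseteq> S q v"
            using open_S zero open_contains_cball by blast
          have "subharmonic_on (S q v) (g q v)"
            using psh False unfolding quat_psh_on_def S_def g_def[abs_def] by blast
          then have "eventually (\<lambda>r. g q v 0 \<le> (LINT y:sphere 0 r|sphere_measure 0 r. g q v y))
              (at_right 0)"
            using zero unfolding subharmonic_on_def by (auto elim!: ballE[of _ _ 0] eventually_mono)
          moreover have "eventually (\<lambda>r. 0 < r \<and> r < \<delta> \<and> r < R) (at_right 0)"
            using \<delta>(1) R(1) by (intro eventually_at_rightI[of 0 "min \<delta> R"]) auto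
          ultimately have "eventually (\<lambda>r. 0 < r \<and> r < \<delta> \<and> r < R \<and>
              g q v 0 \<le> (LINT y:sphere 0 r|sphere_measure 0 r. g q v y)) (at_right 0)"
            by eventually_elim auto
          then obtain r where r: "0 < r" "r < \<delta>" "r < R"
            and sub: "g q v 0 \<le> (LINT y:sphere 0 r|sphere_measure 0 r. g q v y)"
            using eventually_happens trivial_limit_at_right_real by blast
          have "8 * ((LINT y:sphere 0 r|sphere_measure 0 r. g q v y) - g q v 0) \<le> - \<eta> * r\<^sup>2"
          proof (rule sphere_mean_le_second_difference[OF r(1)])
            show "continuous_on (cball 0 r) (g q v)"
              by (rule continuous_on_subset[OF cont_g]) (use R r in auto)
            show "(\<Sum>c\<in>Basis. g q v (0 + c * u) + g q v (0 - c * u) - 2 * g q v 0) \<le> - \<eta> * r\<^sup>2"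
              if "norm u = r" for u
            proof -
              have "(norm u)\<^sup>2 * L (q + scaleQ_right v 0) v = - 2 * (\<eta> * r\<^sup>2)"
                using \<eta>(2) zero that by simp
              then show ?thesis using \<delta>(2)[of u] r that by simp
            qed
          qed
          moreover have "\<eta> * r\<^sup>2 > 0" using \<eta> r by simp
          ultimately show False using sub by simp
        qed
      qed
      then show "nonneg_definite (quat_hessian f q)" using nonneg_iff[OF q] by blast
    qed
  next
    assume "\<forall>q\<in>\<Omega>. nonneg_definite (quat_hessian f q)"
    then have L: "0 \<le> L q v" if "q \<in> \<Omega>" for q v
      using nonneg_iff that by blast
    have "subharmonic_on (S a v) (g a v)" for a v
      unfolding subharmonic_on_def
    proof (intro conjI ballI)
      show "usc_on (S a v) (g a v)" by (rule usc_on_continuous[OF cont_g])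
      fix x assume "x \<in> S a v"
      then obtain R where R: "R > 0" "cball x R \<subseteq> S a v"
        using open_S open_contains_cball by blast
      have "sphere x r \<subseteq> S a v \<and> set_integrable (sphere_measure x r) (sphere x r) (g a v) \<and>
          g a v x \<le> (LINT y:sphere x r|sphere_measure x r. g a v y)" if r: "0 < r" "r < R" for r
      proof (intro conjI)
        have sub: "cball x r \<subseteq> S a v" using R r by auto
        then show "sphere x r \<subseteq> S a v" by auto
        have "continuous_on (sphere x r) (g a v)"
          by (rule continuous_on_subset[OF cont_g]) (use sub in auto)
        then show "set_integrable (sphere_measure x r) (sphere x r) (g a v)"
          by (intro set_integrable_sphere_measure) auto
        show "g a v x \<le> (LINT y:sphere x r|sphere_measure x r. g a v y)"
        proof (rule sub_mean_value[OF r(1)])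
          show "continuous_on (cball x r) (g a v)"
            by (rule continuous_on_subset[OF cont_g sub])
          fix \<eta> :: real assume \<eta>: "\<eta> > 0"
          obtain \<delta> where \<delta>: "\<delta> > 0" "\<And>p u. p \<in> cball x r \<Longrightarrow> norm u < \<delta> \<Longrightarrow>
              \<bar>(\<Sum>c\<in>Basis. g a v (p + c * u) + g a v (p - c * u) - 2 * g a v p)
                - (norm u)\<^sup>2 * L (a + scaleQ_right v p) v\<bar> \<le> \<eta> * (norm u)\<^sup>2"
            by (rule second_difference[of "cball x r" a v \<eta>]) (use sub \<eta> in \<open>auto simp: S_def\<close>)
          show "\<exists>\<delta>>0. \<forall>p\<in>cball x r. \<forall>u. norm u < \<delta> \<longrightarrow> - \<eta> * (norm u)\<^sup>2
              \<le> (\<Sum>c\<in>Basis. g a v (p + c * u) + g a v (p - c * u) - 2 * g a v p)"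
          proof (intro exI[of _ \<delta>] conjI ballI allI impI \<delta>(1))
            fix p u :: quat assume p: "p \<in> cball x r" and u: "norm u < \<delta>"
            have "0 \<le> (norm u)\<^sup>2 * L (a + scaleQ_right v p) v"
              using sub p by (intro mult_nonneg_nonneg L) (auto simp: S_def)
            then show "- \<eta> * (norm u)\<^sup>2
                \<le> (\<Sum>c\<in>Basis. g a v (p + c * u) + g a v (p - c * u) - 2 * g a v p)"
              using \<delta>(2)[OF p u] by linarith
          qed
        qed
      qed
      then show "eventually (\<lambda>r. sphere x r \<subseteq> S a v \<and>
          set_integrable (sphere_measure x r) (sphere x r) (g a v) \<and>
          g a v x \<le> (LINT y:sphere x r|sphere_measure x r. g a v y)) (at_right 0)"
        using R(1) by (intro eventually_at_rightI[of 0 R]) auto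
    qed
    then show "quat_psh_on \<Omega> f"
      unfolding quat_psh_on_def using usc_on_continuous[OF cont_f]
      by (simp add: S_def g_def[abs_def])
  qed
qed

end
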